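(* Let $\Lambda=\{(\lambda_i,m_i)\}_{i=1}^q\subset\mathbb{R}\times\mathbb{Z}_+$ be a spectrum (eigenvalue-multiplicity pairs) with $\sum_{i=1}^q m_i=n$, and let $\mathcal{E}=\{X\in\mathbb{S}^n : \mathrm{Tr}(C_kX)=b_k,\ k=1,\dots,\ell\}$ be an affine space, where $C_1,\dots,C_\ell\in\mathbb{S}^n$ and $b_1,\dots,b_\ell\in\mathbb{R}$. Let $\mathcal{R}_2(\Lambda,\mathcal{E})$, $\mathcal{I}_2$ and $\Sigma$ be the sets associated with these data that are defined in the context. Then exactly one of the following two statements is true: (1) $\mathcal{R}_2(\Lambda,\mathcal{E})$ is nonempty; (2) $-1\in\mathcal{I}_2+\Sigma$, where $-1$ denotes the constant polynomial and $\mathcal{I}_2+\Sigma=\{f+p : f\in\mathcal{I}_2,\ p\in\Sigma\}$.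
   Context: $\mathbb{S}^n$ is the space of $n\times n$ real symmetric matrices with the trace inner product $\langle X,Y\rangle=\mathrm{Tr}(XY)$, $I$ is the $n\times n$ identity, and $\succeq0$ means (self-adjoint and) positive semidefinite; for a linear operator on $(\mathbb{S}^n)^q$ this is with respect to the inner product $\sum_{i=1}^q\mathrm{Tr}(X_iY_i)$. Multiplicities $m_i\in\mathbb{Z}_+$ are positive integers. Polynomials. Let $Z_1,\dots,Z_q$ be symmetric $n\times n$ matrices of indeterminates (the independent indeterminates being the entries $(Z_i)_{s,t}$ with $1\le s\le t\le n$, $1\le i\le q$). Let $\mathbb{R}[Z]$ be the ring of real polynomials in all these indeterminates. Let $\Sigma\subset\mathbb{R}[Z]$ be the set of polynomials that are finite sums of squares of elements of $\mathbb{R}[Z]$. Define the following (scalar or symmetric-matrix valued) polynomials: - $f_1=\sum_{i=1}^q Z_i-I$; - $f_2^{(i)}=\mathrm{Tr}(Z_i)-m_i$ for $i=1,\dots,q$; - $f_3^{(i)}=Z_i^2-Z_i$ for $i=1,\dots,q$; - $f_4^{(k)}=\sum_{i=1}^q\lambda_i\mathrm{Tr}(Z_iC_k)-b_k$ for $k=1,\dots,\ell$. Truncated ideal $\mathcal{I}_2$: the set of all polynomials $$\mathrm{Tr}\big(h_1(Z_1,\dots,Z_q)f_1\big)+\sum_{i=1}^q\Big[h_2^{(i)}(Z_1,\dots,Z_q)f_2^{(i)}+\mathrm{Tr}(h_3^{(i)}f_3^{(i)})\Big]+\sum_{k=1}^\ell h_4^{(k)}(Z_1,\dots,Z_q)f_4^{(k)},$$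 where $h_1$ is an $\mathbb{S}^n$-valued affine polynomial (a symmetric matrix whose entries are polynomials of degree at most one) in $(Z_1,\dots,Z_q)$, each $h_2^{(i)}$ and each $h_4^{(k)}$ is a real-valued affine polynomial in $(Z_1,\dots,Z_q)$, and each $h_3^{(i)}\in\mathbb{S}^n$ is constant (does not depend on the variables). Notation for $\mathcal{R}_2$. $\delta_{s,t}$ is the Kronecker delta. With $e_1,\dots,e_n$ the standard basis of $\mathbb{R}^n$, let $f_{s,t}=e_se_t^T$ if $s=t$ and $f_{s,t}=\frac12(e_se_t^T+e_te_s^T)$ otherwise, for $s,t=1,\dots,n$ (these matrices are unrelated to the polynomials $f_1,f_2^{(i)},f_3^{(i)},f_4^{(k)}$). Relaxation $\mathcal{R}_2(\Lambda,\mathcal{E})$: the set of $(Z_1,\dots,Z_q)\in(\mathbb{S}^n)^q$ for which there exist linear operators $\mathcal{W}_{i,j}:\mathbb{S}^n\to\mathbb{S}^n$, $i,j=1,\dots,q$, and a linear operator $\mathfrak{W}:(\mathbb{S}^n)^q\to(\mathbb{S}^n)^q$ such that: - $\mathfrak{W}\succeq0$ and $[\mathfrak{W}(X_1,\dots,X_q)]_i=\sum_{j=1}^q\mathcal{W}_{i,j}(X_j)$ for $i=1,\dots,q$ and all $X_1,\dots,X_q\in\mathbb{S}^n$; - $Z_i\succeq0$ for $i=1,\dots,q$; - $\sum_{i=1}^qZ_i=I$; $\mathrm{Tr}(Z_i)=m_i$ for $i=1,\dots,q$; $\sum_{i=1}^q\lambda_i\mathrm{Tr}(Z_iC_k)=b_k$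 for $k=1,\dots,\ell$; - $\sum_{j=1}^q\mathcal{W}_{i,j}(f_{s,t})=\delta_{s,t}Z_i$ for $s,t=1,\dots,n$ and $i=1,\dots,q$; - $\sum_{s=1}^n\mathcal{W}_{i,j}(f_{s,s})=m_jZ_i$ for $i,j=1,\dots,q$; - $\sum_{r=1}^n\mathrm{Tr}\big(f_{s,r}\,\mathcal{W}_{i,i}(f_{t,r})\big)=(Z_i)_{s,t}$ for $i=1,\dots,q$ and $s,t=1,\dots,n$; - $\sum_{j=1}^q\lambda_j\mathcal{W}_{i,j}(C_k)=b_kZ_i$ for $i=1,\dots,q$ and $k=1,\dots,\ell$. *)

theory Defs
  imports "HOL-Analysis.Analysis" "HOL-Library.Poly_Mapping" "HOL-Library.Uprod"
begin

text \<open>Throughout, the dimension \<open>n\<close> is \<open>CARD('n)\<close> and \<open>q\<close> is \<open>CARD('q)\<close>; the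
  affine constraints are indexed by \<open>k \<in> {1..l}\<close>, so \<open>l = 0\<close> is allowed.\<close>

definition sym_mats :: "(real^'n^'n) set" where
  "sym_mats = {X. transpose X = X}"

definition sym_tuples :: "(real^'n^'n^'q) set" where
  "sym_tuples = {X. \<forall>i. X $ i \<in> sym_mats}"

definition psd_mat :: "real^'n^'n \<Rightarrow> bool" where
  "psd_mat A \<longleftrightarrow> A \<in> sym_mats \<and> (\<forall>v. 0 \<le> v \<bullet> (A *v v))"

text \<open>Linearity of an operator on a subspace \<open>S\<close>; its values outside \<open>S\<close> are irrelevant.\<close>

definition lin_op_on :: "'v::real_vector set \<Rightarrow> ('v \<Rightarrow> 'v) \<Rightarrow> bool" where
  "lin_op_on S f \<longleftrightarrow>
     (\<forall>x\<in>S. f x \<in> S) \<and>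
     (\<forall>x\<in>S. \<forall>y\<in>S. f (x + y) = f x + f y) \<and>
     (\<forall>c. \<forall>x\<in>S. f (c *\<^sub>R x) = c *\<^sub>R f x)"

definition tuple_inner :: "real^'n^'n^'q \<Rightarrow> real^'n^'n^'q \<Rightarrow> real" where
  "tuple_inner X Y = (\<Sum>i\<in>UNIV. trace (X $ i ** Y $ i))"

definition psd_op :: "(real^'n^'n^'q \<Rightarrow> real^'n^'n^'q) \<Rightarrow> bool" where
  "psd_op T \<longleftrightarrow>
     (\<forall>X\<in>sym_tuples. \<forall>Y\<in>sym_tuples. tuple_inner (T X) Y = tuple_inner X (T Y)) \<and>
     (\<forall>X\<in>sym_tuples. 0 \<le> tuple_inner X (T X))"

definition outer :: "real^'n \<Rightarrow> real^'n \<Rightarrow> real^'n^'n" where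
  "outer u v = (\<chi> i j. u $ i * v $ j)"

definition fmat :: "'n \<Rightarrow> 'n \<Rightarrow> real^'n^'n" where
  "fmat s t =
     (if s = t then outer (axis s 1) (axis s 1)
      else (1/2) *\<^sub>R (outer (axis s 1) (axis t 1) + outer (axis t 1) (axis s 1)))"

definition relax2 ::
  "('q::finite \<Rightarrow> real) \<Rightarrow> ('q \<Rightarrow> nat) \<Rightarrow> nat \<Rightarrow> (nat \<Rightarrow> real^'n^'n) \<Rightarrow> (nat \<Rightarrow> real)
     \<Rightarrow> (real^'n^'n^'q) set" where
  "relax2 lam m l C b =
    {Z \<in> sym_tuples.
      \<exists>(W :: 'q \<Rightarrow> 'q \<Rightarrow> real^'n^'n \<Rightarrow> real^'n^'n) (T :: real^'n^'n^'q \<Rightarrow> real^'n^'n^'q).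
        (\<forall>i j. lin_op_on sym_mats (W i j)) \<and> lin_op_on sym_tuples T \<and>
        psd_op T \<and>
        (\<forall>X\<in>sym_tuples. \<forall>i. T X $ i = (\<Sum>j\<in>UNIV. W i j (X $ j))) \<and>
        (\<forall>i. psd_mat (Z $ i)) \<and>
        (\<Sum>i\<in>UNIV. Z $ i) = mat 1 \<and>
        (\<forall>i. trace (Z $ i) = real (m i)) \<and>
        (\<forall>k\<in>{1..l}. (\<Sum>i\<in>UNIV. lam i * trace (Z $ i ** C k)) = b k) \<and>
        (\<forall>s t i. (\<Sum>j\<in>UNIV. W i j (fmat s t)) = (if s = t then 1 else 0) *\<^sub>R Z $ i) \<and>
        (\<forall>i j. (\<Sum>s\<in>UNIV. W i j (fmat s s)) = real (m j) *\<^sub>R Z $ i) \<and>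
        (\<forall>i s t. (\<Sum>r\<in>UNIV. trace (fmat s r ** W i i (fmat t r))) = Z $ i $ s $ t) \<and>
        (\<forall>i. \<forall>k\<in>{1..l}. (\<Sum>j\<in>UNIV. lam j *\<^sub>R W i j (C k)) = b k *\<^sub>R Z $ i)}"

text \<open>The indeterminates \<open>(Z\<^sub>i)\<^sub>s\<^sub>t = (Z\<^sub>i)\<^sub>t\<^sub>s\<close> are indexed by \<open>i\<close> and the unordered pair of
  \<open>s\<close> and \<open>t\<close>. A monomial is a finitely supported exponent map and a polynomial a finitely
  supported coefficient map on monomials, with the convolution product.\<close>

type_synonym ('q, 'n) zpoly = "(('q \<times> 'n uprod) \<Rightarrow>\<^sub>0 nat) \<Rightarrow>\<^sub>0 real"

definition const_poly :: "real \<Rightarrow> ('q, 'n) zpoly" where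
  "const_poly c = Poly_Mapping.single 0 c"

definition var_poly :: "'q \<Rightarrow> 'n \<Rightarrow> 'n \<Rightarrow> ('q, 'n) zpoly" where
  "var_poly i s t = Poly_Mapping.single (Poly_Mapping.single (i, Upair s t) 1) 1"

definition const_mat :: "real^'n^'n \<Rightarrow> ('q, 'n) zpoly^'n^'n" where
  "const_mat A = (\<chi> s t. const_poly (A $ s $ t))"

definition var_mat :: "'q \<Rightarrow> ('q, 'n) zpoly^'n^'n" where
  "var_mat i = (\<chi> s t. var_poly i s t)"

definition affine_poly :: "('q, 'n) zpoly \<Rightarrow> bool" where
  "affine_poly p \<longleftrightarrow>
     (\<forall>\<alpha>\<in>Poly_Mapping.keys p. (\<Sum>v\<in>Poly_Mapping.keys \<alpha>. Poly_Mapping.lookup \<alpha> v) \<le> 1)"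

definition sos_polys :: "('q, 'n) zpoly set" where
  "sos_polys = {p. \<exists>N::nat. \<exists>g :: nat \<Rightarrow> ('q, 'n) zpoly. p = (\<Sum>j<N. (g j)\<^sup>2)}"

definition f1 :: "('q::finite, 'n) zpoly^'n^'n" where
  "f1 = (\<Sum>i\<in>UNIV. var_mat i) - mat 1"

definition f2 :: "('q \<Rightarrow> nat) \<Rightarrow> 'q \<Rightarrow> ('q, 'n::finite) zpoly" where
  "f2 m i = trace (var_mat i) - const_poly (real (m i))"

definition f3 :: "'q \<Rightarrow> ('q, 'n::finite) zpoly^'n^'n" where
  "f3 i = var_mat i ** var_mat i - var_mat i"

definition f4 ::
  "('q::finite \<Rightarrow> real) \<Rightarrow> (nat \<Rightarrow> real^'n^'n) \<Rightarrow> (nat \<Rightarrow> real) \<Rightarrow> nat \<Rightarrow> ('q, 'n) zpoly" where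
  "f4 lam C b k =
     (\<Sum>i\<in>UNIV. const_poly (lam i) * trace (var_mat i ** const_mat (C k))) - const_poly (b k)"

definition ideal2 ::
  "('q::finite \<Rightarrow> real) \<Rightarrow> ('q \<Rightarrow> nat) \<Rightarrow> nat \<Rightarrow> (nat \<Rightarrow> real^'n^'n) \<Rightarrow> (nat \<Rightarrow> real)
     \<Rightarrow> ('q, 'n) zpoly set" where
  "ideal2 lam m l C b =
    {p. \<exists>(h1 :: ('q, 'n) zpoly^'n^'n) (h2 :: 'q \<Rightarrow> ('q, 'n) zpoly)
         (h3 :: 'q \<Rightarrow> real^'n^'n) (h4 :: nat \<Rightarrow> ('q, 'n) zpoly).
        transpose h1 = h1 \<and> (\<forall>s t. affine_poly (h1 $ s $ t)) \<and>
        (\<forall>i. affine_poly (h2 i)) \<and>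
        (\<forall>i. h3 i \<in> sym_mats) \<and>
        (\<forall>k\<in>{1..l}. affine_poly (h4 k)) \<and>
        p = trace (h1 ** f1)
            + (\<Sum>i\<in>UNIV. h2 i * f2 m i + trace (const_mat (h3 i) ** f3 i))
            + (\<Sum>k\<in>{1..l}. h4 k * f4 lam C b k)}"

end

theory Submission imports Defs begin

text \<open>Both statements are compared with the existence of a linear functional $L$ on polynomials
  with $L(1) = 1$ that vanishes on $\mathcal{I}_2$ and is nonnegative on squares of affine
  polynomials. A point of the relaxation yields such an $L$ with $L((Z_i)_{s,t})$ the entries of
  $Z_i$ and $L((Z_i)_{s,t}(Z_j)_{k,r})$ the entries of $\mathcal{W}_{i,j}(f_{k,r})$, and conversely.
  Such an $L$ excludes $-1 \in \mathcal{I}_2 + \Sigma$, because the squares in a certificate are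
  squares of affine polynomials for degree reasons. If $-1 \notin \mathcal{I}_2 + \Sigma$, a separating
  hyperplane gives $L$; it can be normalised, since $\mathcal{I}_2$ contains
  $m_i - \mathrm{Tr}(Z_i^2)$ and hence 1 is an order unit among the quadratic polynomials.\<close>

subsection \<open>Polynomials of bounded degree\<close>

text \<open>The cone is not known to be closed, so separating it from -1 yields only a nonzero form
  that is nonnegative on the cone and might vanish at 1. The order unit excludes exactly this
  degenerate case: a form vanishing at 1 would vanish on all products of two basis polynomials and
  so be zero. Hyperplanes are taken in a Euclidean space, that of coefficient matrices indexed by 1
  and the entries of the Z_i, while functionals live on polynomials. This indexing is redundant: the
  positions (s,t) and (t,s) carry the same indeterminate, and products commute. Both times a
  functional is constructed, the underlying form must be shown to respect these coincidences. Sigma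
  has no degree bound of its own, so the bound on the squares in a certificate has to come from the
  ideal part.\<close>

lemma const_poly_0 [simp]: "const_poly 0 = 0"
  by (simp add: const_poly_def)

lemma const_poly_1 [simp]: "const_poly 1 = 1"
  by (simp add: const_poly_def)

lemma const_poly_add: "const_poly (c + d) = const_poly c + const_poly d"
  by (simp add: const_poly_def single_add)

lemma const_poly_mult: "const_poly (c * d) = const_poly c * const_poly d"
  by (simp add: const_poly_def mult_single)

lemma const_poly_uminus: "const_poly (- c) = - const_poly c"
  by (simp add: const_poly_def single_uminus)

lemma lookup_const_poly_mult:
  "Poly_Mapping.lookup (const_poly c * p) \<alpha> = c * Poly_Mapping.lookup p \<alpha>"
  unfolding const_poly_def mult_map_scale_conv_mult[symmetric]
  by (simp add: map.rep_eq when_def)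

definition mono_degree :: "('a \<Rightarrow>\<^sub>0 nat) \<Rightarrow> nat" where
  "mono_degree \<alpha> = (\<Sum>v\<in>Poly_Mapping.keys \<alpha>. Poly_Mapping.lookup \<alpha> v)"

lemma mono_degree_0 [simp]: "mono_degree 0 = 0"
  by (simp add: mono_degree_def)

lemma mono_degree_single [simp]: "mono_degree (Poly_Mapping.single v k) = k"
  by (simp add: mono_degree_def)

lemma mono_degree_add: "mono_degree (\<alpha> + \<beta>) = mono_degree \<alpha> + mono_degree \<beta>"
  unfolding mono_degree_def by (rule setsum_keys_plus_distrib) auto

lemma mono_degree_eq_0_iff: "mono_degree \<alpha> = 0 \<longleftrightarrow> \<alpha> = 0"
proof
  assume "mono_degree \<alpha> = 0"
  then have "\<forall>v\<in>Poly_Mapping.keys \<alpha>. Poly_Mapping.lookup \<alpha> v = 0"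
    by (simp add: mono_degree_def)
  then show "\<alpha> = 0"
    by (intro poly_mapping_eqI) (auto simp: in_keys_iff)
qed simp

lemma mono_split:
  assumes "mono_degree \<alpha> \<le> Suc k"
  obtains "\<alpha> = 0" | v \<beta> where "\<alpha> = Poly_Mapping.single v 1 + \<beta>" "mono_degree \<beta> \<le> k"
proof (cases "\<alpha> = 0")
  case False
  then obtain v where v: "Poly_Mapping.lookup \<alpha> v \<noteq> 0"
    by (metis lookup_zero poly_mapping_eqI)
  define \<beta> where "\<beta> = \<alpha> - Poly_Mapping.single v 1"
  have "\<alpha> = Poly_Mapping.single v 1 + \<beta>"
    using v by (intro poly_mapping_eqI)
      (auto simp: \<beta>_def lookup_add lookup_minus lookup_single when_def)
  moreover from this have "mono_degree \<beta> \<le> k"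
    using assms by (metis Suc_le_mono mono_degree_add mono_degree_single plus_1_eq_Suc)
  ultimately show ?thesis using that by blast
qed (use that in blast)

definition poly_degree_le :: "nat \<Rightarrow> ('q, 'n) zpoly \<Rightarrow> bool" where
  "poly_degree_le d p \<longleftrightarrow> (\<forall>\<alpha>\<in>Poly_Mapping.keys p. mono_degree \<alpha> \<le> d)"

lemma affine_poly_iff_degree: "affine_poly p \<longleftrightarrow> poly_degree_le 1 p"
  by (simp add: affine_poly_def poly_degree_le_def mono_degree_def)

lemma poly_degree_le_0 [simp]: "poly_degree_le d 0"
  by (simp add: poly_degree_le_def)

lemma poly_degree_le_const [simp]: "poly_degree_le d (const_poly c)"
  by (simp add: poly_degree_le_def const_poly_def)

lemma poly_degree_le_1 [simp]: "poly_degree_le d 1"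
  using poly_degree_le_const[of d 1] by simp

lemma poly_degree_le_var [simp]: "1 \<le> d \<Longrightarrow> poly_degree_le d (var_poly i s t)"
  by (simp add: poly_degree_le_def var_poly_def)

lemma poly_degree_le_add:
  "poly_degree_le d p \<Longrightarrow> poly_degree_le d r \<Longrightarrow> poly_degree_le d (p + r)"
  unfolding poly_degree_le_def using Poly_Mapping.keys_add[of p r] by blast

lemma poly_degree_le_mult:
  assumes "poly_degree_le d p" "poly_degree_le e r"
  shows "poly_degree_le (d + e) (p * r)"
  unfolding poly_degree_le_def
proof
  fix \<alpha> assume "\<alpha> \<in> Poly_Mapping.keys (p * r)"
  then obtain \<beta> \<gamma> where "\<alpha> = \<beta> + \<gamma>" "\<beta> \<in> Poly_Mapping.keys p" "\<gamma> \<in> Poly_Mapping.keys r"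
    using keys_mult[of p r] by blast
  then show "mono_degree \<alpha> \<le> d + e"
    using assms by (auto simp: poly_degree_le_def mono_degree_add intro: add_mono)
qed

lemma poly_degree_le_const_mult:
  "poly_degree_le d p \<Longrightarrow> poly_degree_le d (const_poly c * p)"
  using poly_degree_le_mult[of 0 "const_poly c" d p] by simp

lemma poly_degree_le_uminus: "poly_degree_le d (- p) \<longleftrightarrow> poly_degree_le d p"
  by (simp add: poly_degree_le_def in_keys_iff)

lemma poly_degree_le_diff:
  "poly_degree_le d p \<Longrightarrow> poly_degree_le d r \<Longrightarrow> poly_degree_le d (p - r)"
  using poly_degree_le_add[of d p "- r"] by (simp add: poly_degree_le_uminus)

lemma poly_degree_le_sum:
  "(\<And>x. x \<in> A \<Longrightarrow> poly_degree_le d (f x)) \<Longrightarrow> poly_degree_le d (sum f A)"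
  by (induction A rule: infinite_finite_induct) (auto intro: poly_degree_le_add)

lemma poly_expand:
  "p = (\<Sum>\<alpha>\<in>Poly_Mapping.keys p. Poly_Mapping.single \<alpha> (Poly_Mapping.lookup p \<alpha>))"
  by (rule poly_mapping_eqI)
    (auto simp: lookup_sum lookup_single when_def in_keys_iff sum.delta)

text \<open>If $2\alpha = \beta + \gamma$ with $\beta, \gamma$ among the monomials of the \<open>g j\<close> and
  $\alpha$ of maximal degree and, within that degree, of maximal Euclidean norm, then the
  parallelogram identity forces $\beta = \gamma = \alpha$. The coefficient of $2\alpha$ in the sum
  of squares is thus a nonempty sum of positive squares and cannot cancel.\<close>

lemma sos_degree_le:
  fixes g :: "nat \<Rightarrow> ('q, 'n) zpoly"
  assumes deg: "poly_degree_le (2 * d) (\<Sum>j<N. (g j)\<^sup>2)" and "j < N"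
  shows "poly_degree_le d (g j)"
proof (rule ccontr)
  assume neg: "\<not> poly_degree_le d (g j)"
  define A where "A = (\<Union>j<N. Poly_Mapping.keys (g j))"
  define D where "D = Max (mono_degree ` A)"
  define A' where "A' = {\<alpha>\<in>A. mono_degree \<alpha> = D}"
  define V where "V = (\<Union>\<alpha>\<in>A. Poly_Mapping.keys \<alpha>)"
  \<comment> \<open>Squared Euclidean length of the exponent vector over the finitely many
    indeterminates that occur. Integer values permit the subtractions in the parallelogram
    identity.\<close>
  define nrm :: "('q \<times> 'n uprod \<Rightarrow>\<^sub>0 nat) \<Rightarrow> int"
    where "nrm \<alpha> = (\<Sum>v\<in>V. (int (Poly_Mapping.lookup \<alpha> v))\<^sup>2)" for \<alpha>
  have finA: "finite A" by (auto simp: A_def)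
  have finV: "finite V" using finA by (auto simp: V_def)
  obtain \<alpha>0 where a0: "\<alpha>0 \<in> A" "d < mono_degree \<alpha>0"
    using neg \<open>j < N\<close> by (auto simp: poly_degree_le_def A_def not_le)
  have Dmax: "mono_degree \<alpha> \<le> D" if "\<alpha> \<in> A" for \<alpha>
    using finA that by (simp add: D_def)
  have "d < D" using Dmax[OF a0(1)] a0(2) by simp
  have "D \<in> mono_degree ` A" unfolding D_def using finA a0 by (intro Max_in) auto
  then have "A' \<noteq> {}" by (auto simp: A'_def)
  have finA': "finite A'" using finA by (simp add: A'_def)
  have "Max (nrm ` A') \<in> nrm ` A'" using finA' \<open>A' \<noteq> {}\<close> by (intro Max_in) auto
  then obtain \<alpha> where \<alpha>: "\<alpha> \<in> A'" "nrm \<alpha> = Max (nrm ` A')" by auto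
  have nmax: "nrm \<beta> \<le> nrm \<alpha>" if "\<beta> \<in> A'" for \<beta>
    using that finA' by (simp add: \<alpha>(2))
  have extreme: "\<beta> = \<alpha> \<and> \<gamma> = \<alpha>" if "\<beta> \<in> A" "\<gamma> \<in> A" and eq: "\<alpha> + \<alpha> = \<beta> + \<gamma>" for \<beta> \<gamma>
  proof -
    have "mono_degree \<beta> + mono_degree \<gamma> = 2 * D"
      using \<alpha> by (metis (mono_tags, lifting) A'_def eq mem_Collect_eq mono_degree_add mult_2)
    then have "\<beta> \<in> A'" "\<gamma> \<in> A'"
      using Dmax[OF that(1)] Dmax[OF that(2)] that by (auto simp: A'_def)
    then have le: "nrm \<beta> \<le> nrm \<alpha>" "nrm \<gamma> \<le> nrm \<alpha>" by (auto intro: nmax)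
    have lk: "2 * int (Poly_Mapping.lookup \<alpha> v)
        = int (Poly_Mapping.lookup \<beta> v) + int (Poly_Mapping.lookup \<gamma> v)" for v
      using arg_cong[OF eq, of "\<lambda>x. Poly_Mapping.lookup x v"] by (simp add: lookup_add)
    have "(int (Poly_Mapping.lookup \<beta> v) - int (Poly_Mapping.lookup \<gamma> v))\<^sup>2
        = 2 * (int (Poly_Mapping.lookup \<beta> v))\<^sup>2 + 2 * (int (Poly_Mapping.lookup \<gamma> v))\<^sup>2
          - 4 * (int (Poly_Mapping.lookup \<alpha> v))\<^sup>2" for v
    proof -
      have "4 * (int (Poly_Mapping.lookup \<alpha> v))\<^sup>2 = (2 * int (Poly_Mapping.lookup \<alpha> v))\<^sup>2"
        by simp
      then show ?thesis unfolding lk by (simp add: power2_eq_square algebra_simps)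
    qed
    then have "(\<Sum>v\<in>V. (int (Poly_Mapping.lookup \<beta> v) - int (Poly_Mapping.lookup \<gamma> v))\<^sup>2)
        = 2 * nrm \<beta> + 2 * nrm \<gamma> - 4 * nrm \<alpha>"
      by (simp add: nrm_def sum.distrib sum_subtractf sum_distrib_left)
    also have "\<dots> \<le> 0" using le by simp
    finally have "(\<Sum>v\<in>V. (int (Poly_Mapping.lookup \<beta> v) - int (Poly_Mapping.lookup \<gamma> v))\<^sup>2) = 0"
      by (meson antisym sum_nonneg zero_le_power2)
    then have V: "\<forall>v\<in>V. Poly_Mapping.lookup \<beta> v = Poly_Mapping.lookup \<gamma> v"
      using finV by (simp add: sum_nonneg_eq_0_iff)
    have "Poly_Mapping.lookup \<beta> v = Poly_Mapping.lookup \<gamma> v" for v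
    proof (cases "v \<in> V")
      case False
      then have "v \<notin> Poly_Mapping.keys \<beta>" "v \<notin> Poly_Mapping.keys \<gamma>"
        using that by (auto simp: V_def)
      then show ?thesis by (simp add: in_keys_iff)
    qed (use V in blast)
    then have bg: "\<beta> = \<gamma>" by (rule poly_mapping_eqI)
    have "Poly_Mapping.lookup \<alpha> v = Poly_Mapping.lookup \<gamma> v" for v
      using lk[of v] bg by simp
    then have "\<alpha> = \<gamma>" by (rule poly_mapping_eqI)
    with bg show ?thesis by simp
  qed
  have coeff: "Poly_Mapping.lookup ((g j)\<^sup>2) (\<alpha> + \<alpha>) = (Poly_Mapping.lookup (g j) \<alpha>)\<^sup>2"
    if "j < N" for j
  proof -
    define K where "K = Poly_Mapping.keys (g j)"
    define c where "c = Poly_Mapping.lookup (g j)"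
    have KA: "K \<subseteq> A" and fK: "finite K" using that by (auto simp: A_def K_def)
    have "(g j)\<^sup>2 = (\<Sum>\<beta>\<in>K. \<Sum>\<gamma>\<in>K. Poly_Mapping.single (\<beta> + \<gamma>) (c \<beta> * c \<gamma>))"
      unfolding power2_eq_square
      by (subst (1 2) poly_expand) (simp add: sum_product mult_single K_def c_def)
    then have "Poly_Mapping.lookup ((g j)\<^sup>2) (\<alpha> + \<alpha>)
        = (\<Sum>\<beta>\<in>K. \<Sum>\<gamma>\<in>K. if \<beta> + \<gamma> = \<alpha> + \<alpha> then c \<beta> * c \<gamma> else 0)"
      by (simp add: lookup_sum lookup_single when_def)
    \<comment> \<open>By \<open>extreme\<close>, the only product of two terms landing on \<alpha> +
      \<alpha> is the square of the term at \<alpha>, so no cross terms remain.\<close>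
    also have "\<dots> = (\<Sum>\<beta>\<in>K. \<Sum>\<gamma>\<in>K. if \<gamma> = \<alpha> then (if \<beta> = \<alpha> then c \<beta> * c \<gamma> else 0) else 0)"
      by (intro sum.cong refl) (use extreme KA in \<open>force\<close>)
    also have "\<dots> = (if \<alpha> \<in> K then c \<alpha> * c \<alpha> else 0)"
      by (simp add: fK sum.delta)
    also have "\<dots> = (c \<alpha>)\<^sup>2"
      by (auto simp: K_def c_def in_keys_iff power2_eq_square)
    finally show ?thesis by (simp add: c_def)
  qed
  have "Poly_Mapping.lookup (\<Sum>j<N. (g j)\<^sup>2) (\<alpha> + \<alpha>) = (\<Sum>j<N. (Poly_Mapping.lookup (g j) \<alpha>)\<^sup>2)"
    by (simp add: lookup_sum coeff)
  also have "\<dots> > 0"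
  proof -
    obtain i where "i < N" "\<alpha> \<in> Poly_Mapping.keys (g i)" using \<alpha> by (auto simp: A'_def A_def)
    then show ?thesis by (intro sum_pos2[of _ i]) (auto simp: in_keys_iff)
  qed
  finally have "\<alpha> + \<alpha> \<in> Poly_Mapping.keys (\<Sum>j<N. (g j)\<^sup>2)" by (simp add: in_keys_iff)
  then have "mono_degree (\<alpha> + \<alpha>) \<le> 2 * d" using deg by (auto simp: poly_degree_le_def)
  moreover have "mono_degree \<alpha> = D" using \<alpha> by (simp add: A'_def)
  ultimately show False using \<open>d < D\<close> by (simp add: mono_degree_add)
qed

section \<open>Affine and quadratic polynomials in terms of 1 and the indeterminates\<close>

definition basis_poly :: "('q \<times> 'n \<times> 'n) option \<Rightarrow> ('q, 'n) zpoly" where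
  "basis_poly a = (case a of None \<Rightarrow> 1 | Some (i, s, t) \<Rightarrow> var_poly i s t)"

definition basis_mono :: "('q \<times> 'n \<times> 'n) option \<Rightarrow> ('q \<times> 'n uprod) \<Rightarrow>\<^sub>0 nat" where
  "basis_mono a = (case a of None \<Rightarrow> 0 | Some (i, s, t) \<Rightarrow> Poly_Mapping.single (i, Upair s t) 1)"

lemma basis_poly_eq_single: "basis_poly a = Poly_Mapping.single (basis_mono a) 1"
  by (simp add: basis_poly_def basis_mono_def var_poly_def split: option.split)

lemma basis_poly_simps [simp]: "basis_poly None = 1" "basis_poly (Some (i, s, t)) = var_poly i s t"
  by (simp_all add: basis_poly_def)

lemma basis_poly_mult_eq_iff:
  "basis_poly a * basis_poly b = basis_poly a' * basis_poly b' \<longleftrightarrow>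
    basis_mono a + basis_mono b = basis_mono a' + basis_mono b'"
proof
  assume "basis_poly a * basis_poly b = basis_poly a' * basis_poly b'"
  then have "Poly_Mapping.lookup (basis_poly a * basis_poly b) (basis_mono a + basis_mono b)
     = Poly_Mapping.lookup (basis_poly a' * basis_poly b') (basis_mono a + basis_mono b)" by simp
  then show "basis_mono a + basis_mono b = basis_mono a' + basis_mono b'"
    by (auto simp: basis_poly_eq_single mult_single lookup_single when_def split: if_splits)
qed (simp add: basis_poly_eq_single mult_single)

lemma basis_mono_ex_1: "mono_degree \<alpha> \<le> 1 \<Longrightarrow> \<exists>a. \<alpha> = basis_mono a"
proof -
  have var: "\<exists>a. Poly_Mapping.single v 1 = basis_mono a" for v :: "'q \<times> 'n uprod"
  proof -
    obtain i s t where "v = (i, Upair s t)" by (metis surj_pair uprod_exhaust)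
    then have "Poly_Mapping.single v 1 = basis_mono (Some (i, s, t))" by (simp add: basis_mono_def)
    then show ?thesis by blast
  qed
  assume "mono_degree \<alpha> \<le> 1"
  then have "mono_degree \<alpha> \<le> Suc 0" by simp
  then show ?thesis
  proof (cases rule: mono_split)
    case 1
    then have "\<alpha> = basis_mono None" by (simp add: basis_mono_def)
    then show ?thesis by blast
  next
    case (2 v \<beta>)
    then show ?thesis using var[of v] by (simp add: mono_degree_eq_0_iff)
  qed
qed

lemma basis_mono_ex_2:
  assumes "mono_degree \<alpha> \<le> 2"
  shows "\<exists>a b. \<alpha> = basis_mono a + basis_mono b"
proof -
  have "mono_degree \<alpha> \<le> Suc 1" using assms by simp
  then show ?thesis
  proof (cases rule: mono_split)
    case 1
    then have "\<alpha> = basis_mono None + basis_mono None" by (simp add: basis_mono_def)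
    then show ?thesis by blast
  next
    case (2 v \<beta>)
    then show ?thesis using basis_mono_ex_1[of \<beta>] basis_mono_ex_1[of "Poly_Mapping.single v 1"]
      by (metis mono_degree_single order_refl)
  qed
qed

definition lin_poly :: "(('q::finite \<times> 'n::finite \<times> 'n) option \<Rightarrow> real) \<Rightarrow> ('q, 'n) zpoly" where
  "lin_poly c = (\<Sum>a\<in>UNIV. const_poly (c a) * basis_poly a)"

text \<open>This is z^T M z, where z lists 1 and the matrix entries at ordered positions. Ordered
  positions let traces be summed over full index ranges, at the price of repetitions in z; different
  M may give the same polynomial. The vector type makes the coefficients a Euclidean space in which
  to separate.\<close>

definition quad_poly :: "real^('q::finite \<times> 'n::finite \<times> 'n) option^('q \<times> 'n \<times> 'n) option
    \<Rightarrow> ('q, 'n) zpoly" where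
  "quad_poly M = (\<Sum>a\<in>UNIV. \<Sum>b\<in>UNIV. const_poly (M $ a $ b) * (basis_poly a * basis_poly b))"

lemma quad_poly_add: "quad_poly (M + M') = quad_poly M + quad_poly M'"
  by (simp add: quad_poly_def const_poly_add distrib_right sum.distrib)

lemma quad_poly_scale: "quad_poly (c *\<^sub>R M) = const_poly c * quad_poly M"
  by (simp add: quad_poly_def const_poly_mult sum_distrib_left mult.assoc)

lemma lin_poly_mult: "lin_poly c * lin_poly d = quad_poly (\<chi> a b. c a * d b)"
  by (simp add: quad_poly_def lin_poly_def const_poly_mult sum_product ac_simps)

lemma lin_poly_add: "lin_poly (\<lambda>a. c a + d a) = lin_poly c + lin_poly d"
  by (simp add: lin_poly_def const_poly_add distrib_right sum.distrib)

lemma lin_poly_single: "lin_poly (\<lambda>x. if x = a then r else 0) = const_poly r * basis_poly a"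
proof -
  have "lin_poly (\<lambda>x. if x = a then r else 0)
      = (\<Sum>x\<in>UNIV. if x = a then const_poly r * basis_poly a else 0)"
    unfolding lin_poly_def by (intro sum.cong) auto
  then show ?thesis by simp
qed

lemma quad_poly_single:
  "quad_poly (axis a (axis b r)) = const_poly r * (basis_poly a * basis_poly b)"
proof -
  have "quad_poly (axis a (axis b r))
      = (\<Sum>x\<in>UNIV. \<Sum>y\<in>UNIV. if y = b then if x = a then const_poly r * (basis_poly a * basis_poly b) else 0 else 0)"
    unfolding quad_poly_def by (intro sum.cong) (auto simp: axis_def)
  then show ?thesis by simp
qed

lemma affine_poly_obtain_lin:
  fixes p :: "('q::finite, 'n::finite) zpoly"
  assumes "affine_poly p"
  obtains c where "p = lin_poly c"
proof -
  have "\<exists>c. (\<Sum>\<alpha>\<in>K. Poly_Mapping.single \<alpha> (Poly_Mapping.lookup p \<alpha>)) = lin_poly c"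
    if "finite K" "\<forall>\<alpha>\<in>K. mono_degree \<alpha> \<le> 1" for K
    using that
  proof (induction K rule: finite_induct)
    case empty
    show ?case by (rule exI[of _ "\<lambda>_. 0"]) (simp add: lin_poly_def)
  next
    case (insert \<alpha> K)
    then obtain c where c: "(\<Sum>\<alpha>\<in>K. Poly_Mapping.single \<alpha> (Poly_Mapping.lookup p \<alpha>)) = lin_poly c"
      by auto
    obtain a where "\<alpha> = basis_mono a" using insert.prems basis_mono_ex_1 by blast
    then have "Poly_Mapping.single \<alpha> (Poly_Mapping.lookup p \<alpha>)
        = lin_poly (\<lambda>x. if x = a then Poly_Mapping.lookup p \<alpha> else 0)"
      by (simp add: lin_poly_single basis_poly_eq_single const_poly_def mult_single)
    then show ?case using insert.hyps c by (auto simp: lin_poly_add[symmetric])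
  qed
  from this[of "Poly_Mapping.keys p"] assms poly_expand[of p] that show thesis
    by (auto simp: affine_poly_iff_degree poly_degree_le_def)
qed

lemma quadratic_obtain_quad:
  fixes p :: "('q::finite, 'n::finite) zpoly"
  assumes "poly_degree_le 2 p"
  obtains M where "p = quad_poly M"
proof -
  have "\<exists>M. (\<Sum>\<alpha>\<in>K. Poly_Mapping.single \<alpha> (Poly_Mapping.lookup p \<alpha>)) = quad_poly M"
    if "finite K" "\<forall>\<alpha>\<in>K. mono_degree \<alpha> \<le> 2" for K
    using that
  proof (induction K rule: finite_induct)
    case empty
    show ?case by (rule exI[of _ 0]) (simp add: quad_poly_def)
  next
    case (insert \<alpha> K)
    then obtain M where M: "(\<Sum>\<alpha>\<in>K. Poly_Mapping.single \<alpha> (Poly_Mapping.lookup p \<alpha>)) = quad_poly M"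
      by auto
    obtain a b where "\<alpha> = basis_mono a + basis_mono b" using insert.prems basis_mono_ex_2 by blast
    then have "Poly_Mapping.single \<alpha> (Poly_Mapping.lookup p \<alpha>)
        = quad_poly (axis a (axis b (Poly_Mapping.lookup p \<alpha>)))"
      by (simp add: quad_poly_single basis_poly_eq_single const_poly_def mult_single)
    then show ?case using insert.hyps M by (auto simp: quad_poly_add[symmetric])
  qed
  from this[of "Poly_Mapping.keys p"] assms poly_expand[of p] that show thesis
    by (auto simp: poly_degree_le_def)
qed

section \<open>Linear functionals with prescribed moments of degree at most two\<close>

definition linear_functional :: "(('q, 'n) zpoly \<Rightarrow> real) \<Rightarrow> bool" where
  "linear_functional L \<longleftrightarrow>
    (\<forall>p r. L (p + r) = L p + L r) \<and> (\<forall>c p. L (const_poly c * p) = c * L p)"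

text \<open>The hypothesis makes the prescribed value depend only on the monomial
  \<open>basis_mono a + basis_mono b\<close>. Values on monomials can be chosen freely, since the
  monomials form a basis of the polynomial ring.\<close>

lemma functional_with_moments:
  fixes B :: "('q \<times> 'n \<times> 'n) option \<Rightarrow> ('q \<times> 'n \<times> 'n) option \<Rightarrow> real"
  assumes B: "\<And>a b a' b'. basis_poly a * basis_poly b = basis_poly a' * basis_poly b' \<Longrightarrow>
      B a b = B a' b'"
  obtains L :: "('q, 'n) zpoly \<Rightarrow> real"
  where "linear_functional L" "\<And>a b. L (basis_poly a * basis_poly b) = B a b"
proof -
  \<comment> \<open>Monomials of degree above two receive an unspecified value; the functional is
    later constrained only in degree at most two.\<close>
  define e where "e \<alpha> = (SOME r. \<exists>a b. \<alpha> = basis_mono a + basis_mono b \<and> r = B a b)" for \<alpha>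
  have e: "e (basis_mono a + basis_mono b) = B a b" for a b
    unfolding e_def by (rule some_equality) (use B basis_poly_mult_eq_iff in \<open>metis\<close>)+
  define L :: "('q, 'n) zpoly \<Rightarrow> real"
    where "L p = (\<Sum>\<alpha>\<in>Poly_Mapping.keys p. Poly_Mapping.lookup p \<alpha> * e \<alpha>)" for p
  have L: "L p = (\<Sum>\<alpha>\<in>S. Poly_Mapping.lookup p \<alpha> * e \<alpha>)"
    if "finite S" "Poly_Mapping.keys p \<subseteq> S" for p S
    unfolding L_def using that by (intro sum.mono_neutral_left) (auto simp: in_keys_iff)
  have "L (p + r) = L p + L r" for p r
    using L[of "Poly_Mapping.keys p \<union> Poly_Mapping.keys r"] Poly_Mapping.keys_add[of p r]
    by (simp add: lookup_add distrib_right sum.distrib)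
  moreover have "L (const_poly c * p) = c * L p" for c and p :: "('q, 'n) zpoly"
  proof -
    have "Poly_Mapping.keys (const_poly c * p) \<subseteq> Poly_Mapping.keys p"
      by (auto simp: in_keys_iff lookup_const_poly_mult)
    from L[OF _ this] L[of "Poly_Mapping.keys p" p] show ?thesis
      by (simp add: lookup_const_poly_mult sum_distrib_left mult.assoc)
  qed
  moreover have "L (basis_poly a * basis_poly b) = B a b" for a b
    by (simp add: L_def basis_poly_eq_single mult_single e)
  ultimately show thesis by (intro that[of L]) (simp_all add: linear_functional_def)
qed

subsection \<open>Duality for the truncated cone\<close>

lemma
  assumes "linear_functional L"
  shows linear_functional_add: "L (p + r) = L p + L r"
    and linear_functional_const_mult: "L (const_poly c * p) = c * L p"
    and linear_functional_0: "L 0 = 0"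
    and linear_functional_uminus: "L (- p) = - L p"
    and linear_functional_diff: "L (p - r) = L p - L r"
    and linear_functional_sum: "L (sum f A) = (\<Sum>x\<in>A. L (f x))"
    and linear_functional_const: "L (const_poly c) = c * L 1"
proof -
  show add: "L (p + r) = L p + L r" for p r
    using assms by (simp add: linear_functional_def)
  show scale: "L (const_poly c * p) = c * L p" for c p
    using assms by (simp add: linear_functional_def)
  show zero: "L 0 = 0" using scale[of 0 0] by simp
  show minus: "L (- p) = - L p" for p using add[of p "- p"] zero by simp
  show "L (p - r) = L p - L r" using add[of p "- r"] minus by simp
  show "L (sum f A) = (\<Sum>x\<in>A. L (f x))"
    by (induction A rule: infinite_finite_induct) (auto simp: zero add)
  show "L (const_poly c) = c * L 1" using scale[of c 1] by simp
qed

lemmas linear_functional_simps = linear_functional_add linear_functional_const_mult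
  linear_functional_0 linear_functional_uminus linear_functional_diff linear_functional_sum
  linear_functional_const

lemma linear_functional_quad_poly:
  assumes "linear_functional L"
  shows "L (quad_poly M) = (\<Sum>a\<in>UNIV. \<Sum>b\<in>UNIV. M $ a $ b * L (basis_poly a * basis_poly b))"
  unfolding quad_poly_def using assms
  by (simp add: linear_functional_simps)

section \<open>Entrywise form of the relations, and the truncated ideal as a linear space\<close>

lemma var_poly_commute: "var_poly i s t = var_poly i t s"
proof -
  have "Upair s t = Upair t s" by simp
  then show ?thesis unfolding var_poly_def by metis
qed

lemma f1_nth: "f1 $ s $ t = (\<Sum>i\<in>UNIV. var_poly i s t) - const_poly (if s = t then 1 else 0)"
  by (simp add: f1_def var_mat_def mat_def)

lemma f2_expand: "f2 m i = (\<Sum>s\<in>UNIV. var_poly i s s) - const_poly (real (m i))"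
  by (simp add: f2_def var_mat_def trace_def)

lemma f3_nth: "f3 i $ s $ t = (\<Sum>r\<in>UNIV. var_poly i s r * var_poly i r t) - var_poly i s t"
  by (simp add: f3_def var_mat_def matrix_matrix_mult_def)

lemma f4_expand: "f4 lam C b k =
   (\<Sum>i\<in>UNIV. const_poly (lam i) * (\<Sum>s\<in>UNIV. \<Sum>t\<in>UNIV. const_poly (C k $ s $ t) * var_poly i s t))
     - const_poly (b k)"
  by (simp add: f4_def trace_mul_sym[of "var_mat _"])
    (simp add: var_mat_def const_mat_def trace_def matrix_matrix_mult_def var_poly_commute)

lemma trace_mult: "trace (A ** B) = (\<Sum>s\<in>UNIV. \<Sum>t\<in>UNIV. A $ s $ t * B $ t $ s)"
  by (simp add: trace_def matrix_matrix_mult_def)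

lemma trace_zero [simp]: "trace (0 :: 'a::semiring_1^'n^'n) = 0"
  by (simp add: trace_def)

lemma const_mat_nth [simp]: "const_mat A $ s $ t = const_poly (A $ s $ t)"
  by (simp add: const_mat_def)

text \<open>The multipliers are matched to the relations: affine times affine for \<open>f1\<close>,
  \<open>f2\<close>, \<open>f4\<close>, constant times quadratic for \<open>f3\<close>. This is the
  bound that passes to the sum of squares in a certificate.\<close>

lemma ideal2_degree:
  assumes "p \<in> ideal2 lam m l C b"
  shows "poly_degree_le 2 p"
proof -
  obtain h1 h2 h3 h4 where h:
      "\<And>s t. poly_degree_le 1 (h1 $ s $ t)" "\<And>i. poly_degree_le 1 (h2 i)"
      "\<And>k. k \<in> {1..l} \<Longrightarrow> poly_degree_le 1 (h4 k)"
    and p: "p = trace (h1 ** f1)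
            + (\<Sum>i\<in>UNIV. h2 i * f2 m i + trace (const_mat (h3 i) ** f3 i))
            + (\<Sum>k\<in>{1..l}. h4 k * f4 lam C b k)"
    using assms unfolding ideal2_def affine_poly_iff_degree by blast
  have mult: "poly_degree_le 2 (x * y)" if "poly_degree_le 1 x" "poly_degree_le 1 y"
    for x y :: "('a, 'b) zpoly"
    using poly_degree_le_mult[OF that] unfolding one_add_one .
  show ?thesis
    unfolding p trace_mult f1_nth f2_expand f3_nth f4_expand const_mat_nth
    by (intro poly_degree_le_add poly_degree_le_sum mult h poly_degree_le_diff
        poly_degree_le_const_mult) auto
qed

lemma ideal2_zero: "0 \<in> ideal2 lam m l C b"
  unfolding ideal2_def mem_Collect_eq
  by (intro exI[of _ 0] exI[of _ "\<lambda>_. 0"])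
    (simp add: affine_poly_iff_degree sym_mats_def trace_mult vec_eq_iff transpose_def)

lemma ideal2_f1:
  assumes "transpose h = h" "\<And>s t. affine_poly (h $ s $ t)"
  shows "trace (h ** f1) \<in> ideal2 lam m l C b"
  unfolding ideal2_def mem_Collect_eq using assms
  by (intro exI[of _ h] exI[of _ "\<lambda>_. 0"])
    (simp add: affine_poly_iff_degree sym_mats_def trace_mult vec_eq_iff transpose_def)

lemma ideal2_f2:
  assumes "affine_poly h"
  shows "h * f2 m i \<in> ideal2 lam m l C b"
proof -
  have "(\<Sum>j\<in>UNIV. (if j = i then h else 0) * f2 m j) = (\<Sum>j\<in>UNIV. if j = i then h * f2 m i else 0)"
    by (intro sum.cong) auto
  then show ?thesis
    unfolding ideal2_def mem_Collect_eq using assms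
    by (intro exI[of _ 0] exI[of _ "\<lambda>j. if j = i then h else 0"] exI[of _ "\<lambda>_. 0"])
      (simp add: affine_poly_iff_degree sym_mats_def trace_mult vec_eq_iff transpose_def)
qed

lemma ideal2_f3:
  assumes "A \<in> sym_mats"
  shows "trace (const_mat A ** f3 i) \<in> ideal2 lam m l C b"
proof -
  have "(\<Sum>j\<in>UNIV. trace (const_mat (if j = i then A else 0) ** f3 j))
      = (\<Sum>j\<in>UNIV. if j = i then trace (const_mat A ** f3 i) else 0)"
    by (intro sum.cong) (auto simp: trace_mult)
  then show ?thesis
    unfolding ideal2_def mem_Collect_eq using assms
    by (intro exI[of _ 0] exI[of _ "\<lambda>_. 0"] exI[of _ "\<lambda>j. if j = i then A else 0"] exI[of _ "\<lambda>_. 0"])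
      (simp add: affine_poly_iff_degree sym_mats_def vec_eq_iff transpose_def)
qed

lemma ideal2_f4:
  assumes "affine_poly h" "k \<in> {1..l}"
  shows "h * f4 lam C b k \<in> ideal2 lam m l C b"
proof -
  have "(\<Sum>j\<in>{1..l}. (if j = k then h else 0) * f4 lam C b j)
      = (\<Sum>j\<in>{1..l}. if j = k then h * f4 lam C b k else 0)"
    by (intro sum.cong) auto
  then show ?thesis
    unfolding ideal2_def mem_Collect_eq using assms
    by (intro exI[of _ 0] exI[of _ "\<lambda>_. 0"] exI[of _ "\<lambda>j. if j = k then h else 0"])
      (simp add: affine_poly_iff_degree sym_mats_def trace_mult vec_eq_iff transpose_def)
qed

lemma ideal2_add:
  assumes "p \<in> ideal2 lam m l C b" "r \<in> ideal2 lam m l C b"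
  shows "p + r \<in> ideal2 lam m l C b"
proof -
  obtain h1 h2 h3 h4 where h: "transpose h1 = h1" "\<And>s t. affine_poly (h1 $ s $ t)"
      "\<And>i. affine_poly (h2 i)" "\<And>i. h3 i \<in> sym_mats" "\<And>k. k \<in> {1..l} \<Longrightarrow> affine_poly (h4 k)"
    and p: "p = trace (h1 ** f1)
            + (\<Sum>i\<in>UNIV. h2 i * f2 m i + trace (const_mat (h3 i) ** f3 i))
            + (\<Sum>k\<in>{1..l}. h4 k * f4 lam C b k)"
    using assms(1) unfolding ideal2_def by blast
  obtain k1 k2 k3 k4 where k: "transpose k1 = k1" "\<And>s t. affine_poly (k1 $ s $ t)"
      "\<And>i. affine_poly (k2 i)" "\<And>i. k3 i \<in> sym_mats" "\<And>k. k \<in> {1..l} \<Longrightarrow> affine_poly (k4 k)"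
    and r: "r = trace (k1 ** f1)
            + (\<Sum>i\<in>UNIV. k2 i * f2 m i + trace (const_mat (k3 i) ** f3 i))
            + (\<Sum>k\<in>{1..l}. k4 k * f4 lam C b k)"
    using assms(2) unfolding ideal2_def by blast
  have "p + r = trace ((h1 + k1) ** f1)
            + (\<Sum>i\<in>UNIV. (h2 i + k2 i) * f2 m i + trace (const_mat (h3 i + k3 i) ** f3 i))
            + (\<Sum>k\<in>{1..l}. (h4 k + k4 k) * f4 lam C b k)"
    unfolding p r trace_mult
    by (simp add: const_poly_add distrib_right sum.distrib)
  then show ?thesis
    unfolding ideal2_def mem_Collect_eq using h k
    by (intro exI[of _ "h1 + k1"] exI[of _ "\<lambda>i. h2 i + k2 i"] exI[of _ "\<lambda>i. h3 i + k3 i"]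
        exI[of _ "\<lambda>i. h4 i + k4 i"])
      (simp add: affine_poly_iff_degree sym_mats_def poly_degree_le_add vec_eq_iff transpose_def)
qed

lemma ideal2_scale:
  assumes "p \<in> ideal2 lam m l C b"
  shows "const_poly c * p \<in> ideal2 lam m l C b"
proof -
  obtain h1 h2 h3 h4 where h: "transpose h1 = h1" "\<And>s t. affine_poly (h1 $ s $ t)"
      "\<And>i. affine_poly (h2 i)" "\<And>i. h3 i \<in> sym_mats" "\<And>k. k \<in> {1..l} \<Longrightarrow> affine_poly (h4 k)"
    and p: "p = trace (h1 ** f1)
            + (\<Sum>i\<in>UNIV. h2 i * f2 m i + trace (const_mat (h3 i) ** f3 i))
            + (\<Sum>k\<in>{1..l}. h4 k * f4 lam C b k)"
    using assms(1) unfolding ideal2_def by blast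
  define h1' where "h1' = (\<chi> s t. const_poly c * h1 $ s $ t)"
  have "const_poly c * p = trace (h1' ** f1)
            + (\<Sum>i\<in>UNIV. (const_poly c * h2 i) * f2 m i + trace (const_mat (c *\<^sub>R h3 i) ** f3 i))
            + (\<Sum>k\<in>{1..l}. (const_poly c * h4 k) * f4 lam C b k)"
    unfolding p trace_mult h1'_def
    by (simp add: const_poly_mult distrib_left sum_distrib_left mult.assoc)
  then show ?thesis
    unfolding ideal2_def mem_Collect_eq using h
    by (intro exI[of _ h1'] exI[of _ "\<lambda>i. const_poly c * h2 i"] exI[of _ "\<lambda>i. c *\<^sub>R h3 i"]
        exI[of _ "\<lambda>i. const_poly c * h4 i"])
      (simp add: affine_poly_iff_degree sym_mats_def poly_degree_le_const_mult vec_eq_iff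
        transpose_def h1'_def)
qed

lemma ideal2_uminus: "p \<in> ideal2 lam m l C b \<Longrightarrow> - p \<in> ideal2 lam m l C b"
  using ideal2_scale[of p lam m l C b "- 1"] by (simp add: const_poly_uminus)

section \<open>The convex cone of ideal elements plus sums of squares\<close>

lemma sos_zero: "0 \<in> sos_polys"
  unfolding sos_polys_def mem_Collect_eq by (intro exI[of _ 0]) simp

lemma sos_add_square:
  assumes "p \<in> sos_polys"
  shows "p + h\<^sup>2 \<in> sos_polys"
proof -
  obtain N g where "p = (\<Sum>j<(N::nat). (g j)\<^sup>2)" using assms by (auto simp: sos_polys_def)
  then have "p + h\<^sup>2 = (\<Sum>j<Suc N. ((g(N := h)) j)\<^sup>2)" by simp
  then show ?thesis unfolding sos_polys_def by blast
qed

lemma sos_square: "h\<^sup>2 \<in> sos_polys"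
  using sos_add_square[OF sos_zero] by simp

lemma sos_add:
  assumes "p \<in> sos_polys" "r \<in> sos_polys"
  shows "p + r \<in> sos_polys"
proof -
  obtain N g where r: "r = (\<Sum>j<(N::nat). (g j)\<^sup>2)" using assms by (auto simp: sos_polys_def)
  have "p + (\<Sum>j<k. (g j)\<^sup>2) \<in> sos_polys" for k
    by (induction k) (use assms sos_add_square in \<open>auto simp: add.assoc[symmetric]\<close>)
  then show ?thesis by (simp add: r)
qed

lemma sos_sum: "(\<And>x. x \<in> A \<Longrightarrow> f x \<in> sos_polys) \<Longrightarrow> sum f A \<in> sos_polys"
  by (induction A rule: infinite_finite_induct) (auto intro: sos_add sos_zero)

lemma sos_scale:
  fixes p :: "('q, 'n) zpoly"
  assumes "p \<in> sos_polys" "0 \<le> c"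
  shows "const_poly c * p \<in> sos_polys"
proof -
  obtain N :: nat and g :: "nat \<Rightarrow> ('q, 'n) zpoly" where p: "p = (\<Sum>j<N. (g j)\<^sup>2)" using assms by (auto simp: sos_polys_def)
  have "const_poly c = (const_poly (sqrt c) :: ('q, 'n) zpoly)\<^sup>2"
    using assms by (simp add: power2_eq_square const_poly_mult[symmetric])
  then have "const_poly c * p = (\<Sum>j<N. (const_poly (sqrt c) * g j)\<^sup>2)"
    by (simp only: p sum_distrib_left power_mult_distrib)
  then show ?thesis
    unfolding sos_polys_def mem_Collect_eq
    by (intro exI[of _ N] exI[of _ "\<lambda>j. const_poly (sqrt c) * g j"])
qed

definition truncated_cone ::
  "('q::finite \<Rightarrow> real) \<Rightarrow> ('q \<Rightarrow> nat) \<Rightarrow> nat \<Rightarrow> (nat \<Rightarrow> real^'n^'n) \<Rightarrow> (nat \<Rightarrow> real)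
     \<Rightarrow> ('q, 'n) zpoly set" where
  "truncated_cone lam m l C b = {f + p | f p. f \<in> ideal2 lam m l C b \<and> p \<in> sos_polys}"

lemma truncated_cone_ideal: "p \<in> ideal2 lam m l C b \<Longrightarrow> p \<in> truncated_cone lam m l C b"
  unfolding truncated_cone_def using sos_zero by force

lemma truncated_cone_sos: "p \<in> sos_polys \<Longrightarrow> p \<in> truncated_cone lam m l C b"
  unfolding truncated_cone_def using ideal2_zero by force

lemma truncated_cone_add:
  assumes "p \<in> truncated_cone lam m l C b" "r \<in> truncated_cone lam m l C b"
  shows "p + r \<in> truncated_cone lam m l C b"
proof -
  obtain f1 p1 f2 p2 where "p = f1 + p1" "r = f2 + p2"
    and mem: "f1 \<in> ideal2 lam m l C b" "f2 \<in> ideal2 lam m l C b" "p1 \<in> sos_polys" "p2 \<in> sos_polys"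
    using assms unfolding truncated_cone_def by blast
  then have "p + r = (f1 + f2) + (p1 + p2)" by simp
  then show ?thesis
    unfolding truncated_cone_def using mem ideal2_add sos_add by blast
qed

lemma truncated_cone_scale:
  assumes "p \<in> truncated_cone lam m l C b" "0 \<le> c"
  shows "const_poly c * p \<in> truncated_cone lam m l C b"
proof -
  obtain f r where "p = f + r" "f \<in> ideal2 lam m l C b" "r \<in> sos_polys"
    using assms unfolding truncated_cone_def by blast
  then have "const_poly c * p = const_poly c * f + const_poly c * r"
      "const_poly c * f \<in> ideal2 lam m l C b" "const_poly c * r \<in> sos_polys"
    using assms by (auto simp: distrib_left ideal2_scale sos_scale)
  then show ?thesis unfolding truncated_cone_def by blast
qed

text \<open>The relations $\mathrm{Tr}(Z_i^2) - \mathrm{Tr}(Z_i)$ and $\mathrm{Tr}(Z_i) - m_i$ bound the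
  Frobenius norm of every $Z_i$; this compactness is what makes the duality exact.\<close>

lemma square_bounded:
  fixes C :: "nat \<Rightarrow> real^'n^'n" and lam :: "'q::finite \<Rightarrow> real"
  shows "\<exists>N. const_poly N - (basis_poly a)\<^sup>2 \<in> truncated_cone lam m l C b"
proof (cases a)
  case None
  have "const_poly 1 - (1::('q, 'n) zpoly)\<^sup>2 \<in> truncated_cone lam m l C b"
    using truncated_cone_ideal[OF ideal2_zero] by simp
  then show ?thesis unfolding None basis_poly_simps by blast
next
  case (Some v)
  obtain i s t where v: "v = (i, s, t)" by (cases v)
  define g where "g = (\<lambda>(s, t). (var_poly i s t :: ('q, 'n) zpoly)\<^sup>2)"
  have "(\<Sum>s\<in>UNIV. \<Sum>t\<in>UNIV. var_poly i s t * var_poly i t s :: ('q, 'n) zpoly) = sum g UNIV"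
    by (simp add: g_def UNIV_Times_UNIV[symmetric] sum.cartesian_product[symmetric]
        power2_eq_square var_poly_commute[of i _ s for s] del: UNIV_Times_UNIV)
  also have "\<dots> = (var_poly i s t)\<^sup>2 + sum g (UNIV - {(s, t)})"
    by (subst sum.remove[of _ "(s, t)"]) (auto simp: g_def)
  finally have sq: "(\<Sum>s\<in>UNIV. \<Sum>t\<in>UNIV. var_poly i s t * var_poly i t s)
     = (var_poly i s t)\<^sup>2 + sum g (UNIV - {(s, t)})" .
  have "trace (const_mat (mat 1) ** f3 i) = (\<Sum>s\<in>UNIV. f3 i $ s $ s)"
  proof -
    have "trace (const_mat (mat 1) ** f3 i)
       = (\<Sum>s\<in>UNIV. \<Sum>t\<in>UNIV. if t = s then f3 i $ t $ s else 0)"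
      unfolding trace_mult by (intro sum.cong refl) (auto simp: mat_def)
    then show ?thesis by simp
  qed
  also have "\<dots> = (var_poly i s t)\<^sup>2 + sum g (UNIV - {(s, t)}) - (\<Sum>s\<in>UNIV. var_poly i s s)"
    unfolding f3_nth sum_subtractf sq ..
  \<comment> \<open>The constant m_i arises because adding \<open>f2\<close> to
    Tr(\<open>f3\<close>) turns Tr(Z_i^2) - Tr(Z_i) into Tr(Z_i^2) - m_i. The squares of the other
    entries go to the sum of squares.\<close>
  finally have "const_poly (real (m i)) - (var_poly i s t)\<^sup>2
      = - (trace (const_mat (mat 1) ** f3 i) + 1 * f2 m i) + sum g (UNIV - {(s, t)})"
    by (simp add: f2_expand)
  moreover have "trace (const_mat (mat 1) ** f3 i) + 1 * f2 m i \<in> ideal2 lam m l C b"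
    by (intro ideal2_add ideal2_f3 ideal2_f2) (auto simp: sym_mats_def affine_poly_iff_degree)
  moreover have "sum g (UNIV - {(s, t)}) \<in> sos_polys"
    by (intro sos_sum) (auto simp: g_def sos_square)
  ultimately have "const_poly (real (m i)) - (var_poly i s t)\<^sup>2 \<in> truncated_cone lam m l C b"
    by (metis truncated_cone_add truncated_cone_ideal truncated_cone_sos ideal2_uminus)
  then show ?thesis unfolding Some v basis_poly_simps by blast
qed

text \<open>Polarisation: with x, y the two basis polynomials and e a sign, (N + N')/2 + e x y is
  half of (N - x^2) + (N' - y^2) + (x + e y)^2. The two signs bound the product from both sides, so
  a multiple of 1 dominates every quadratic polynomial.\<close>

lemma product_bounded:
  assumes e: "e = 1 \<or> e = - 1"
  shows "\<exists>N. const_poly N + const_poly e * (basis_poly a * basis_poly c) \<in> truncated_cone lam m l C b"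
proof -
  obtain N N' where N: "const_poly N - (basis_poly a)\<^sup>2 \<in> truncated_cone lam m l C b"
      "const_poly N' - (basis_poly c)\<^sup>2 \<in> truncated_cone lam m l C b"
    using square_bounded by meson
  \<comment> \<open>The scalars are made opaque so that ring normalisation treats them as atoms;
    \<open>h + h = 1\<close> and \<open>\<epsilon> * \<epsilon> = 1\<close> enter only afterwards,
    to remove the leftover term.\<close>
  define h where "h = (const_poly (1 / 2) :: ('a, 'b) zpoly)"
  define \<epsilon> where "\<epsilon> = (const_poly e :: ('a, 'b) zpoly)"
  have h: "h + h = 1" by (simp add: h_def const_poly_add[symmetric])
  have e2: "\<epsilon> * \<epsilon> = 1" using e by (auto simp: \<epsilon>_def const_poly_mult[symmetric])
  have hN: "const_poly ((N + N') / 2) = h * const_poly N + h * const_poly N'"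
    by (simp add: h_def const_poly_add[symmetric] const_poly_mult[symmetric] add_divide_distrib)
  have "h * (const_poly N - (basis_poly a)\<^sup>2) + h * (const_poly N' - (basis_poly c)\<^sup>2)
      + h * (basis_poly a + \<epsilon> * basis_poly c)\<^sup>2
     = h * const_poly N + h * const_poly N' + (h + h) * (\<epsilon> * (basis_poly a * basis_poly c))
       + h * (\<epsilon> * \<epsilon> - 1) * (basis_poly c)\<^sup>2"
    by (simp add: power2_eq_square algebra_simps)
  also have "\<dots> = const_poly ((N + N') / 2) + \<epsilon> * (basis_poly a * basis_poly c)"
    by (simp add: h e2 hN)
  finally have "const_poly ((N + N') / 2) + \<epsilon> * (basis_poly a * basis_poly c)
     = h * (const_poly N - (basis_poly a)\<^sup>2) + h * (const_poly N' - (basis_poly c)\<^sup>2)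
      + h * (basis_poly a + \<epsilon> * basis_poly c)\<^sup>2" by simp
  also have "\<dots> \<in> truncated_cone lam m l C b"
    unfolding h_def using N
    by (intro truncated_cone_add truncated_cone_scale) (auto intro: truncated_cone_sos sos_square)
  finally show ?thesis unfolding \<epsilon>_def by blast
qed

text \<open>A pseudo-expectation of degree two. The condition on squares says that the moment matrix
  indexed by 1 and the indeterminates is positive semidefinite; in higher degree only linearity is
  imposed.\<close>

definition feasible_functional ::
  "('q::finite \<Rightarrow> real) \<Rightarrow> ('q \<Rightarrow> nat) \<Rightarrow> nat \<Rightarrow> (nat \<Rightarrow> real^'n^'n) \<Rightarrow> (nat \<Rightarrow> real)
     \<Rightarrow> (('q, 'n) zpoly \<Rightarrow> real) \<Rightarrow> bool" where
  "feasible_functional lam m l C b L \<longleftrightarrow> linear_functional L \<and> L 1 = 1 \<and>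
     (\<forall>p\<in>ideal2 lam m l C b. L p = 0) \<and> (\<forall>g. affine_poly g \<longrightarrow> 0 \<le> L (g\<^sup>2))"

lemma minus_one_notin_cone:
  assumes "feasible_functional lam m l C b L"
  shows "- 1 \<notin> truncated_cone lam m l C b"
proof
  assume "- 1 \<in> truncated_cone lam m l C b"
  then obtain f p where fp: "- 1 = f + p" "f \<in> ideal2 lam m l C b" "p \<in> sos_polys"
    unfolding truncated_cone_def by blast
  then obtain N g where p: "p = (\<Sum>j<(N::nat). (g j)\<^sup>2)" by (auto simp: sos_polys_def)
  have L: "linear_functional L" using assms by (simp add: feasible_functional_def)
  \<comment> \<open>Nothing bounds the degrees of the \<open>g j\<close> beforehand. This identity
    hands the bound 2 of the ideal part to p, and \<open>sos_degree_le\<close> with d = 1 hands it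
    on to each \<open>g j\<close>.\<close>
  have "p = - 1 - f" using fp(1) by (simp add: algebra_simps)
  then have "poly_degree_le (2 * 1) p"
    using ideal2_degree[OF fp(2)] poly_degree_le_diff[of 2 "- 1" f]
    by (simp add: poly_degree_le_uminus)
  then have "affine_poly (g j)" if "j < N" for j
    using sos_degree_le that unfolding p affine_poly_iff_degree by blast
  then have "0 \<le> (\<Sum>j<N. L ((g j)\<^sup>2))"
    using assms by (intro sum_nonneg) (auto simp: feasible_functional_def)
  then have "0 \<le> L p" by (simp add: p linear_functional_sum[OF L])
  moreover have "L f = 0" using assms fp by (simp add: feasible_functional_def)
  moreover have "L (- 1) = - 1"
    using assms by (simp add: feasible_functional_def linear_functional_uminus)
  ultimately show False using linear_functional_add[OF L, of f p] fp(1) by simp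
qed

lemma ex_feasible_functional:
  fixes C :: "nat \<Rightarrow> real^'n^'n" and lam :: "'q::finite \<Rightarrow> real"
  assumes notin: "- 1 \<notin> truncated_cone lam m l C b"
  shows "\<exists>L. feasible_functional lam m l C b L"
proof -
  let ?K = "truncated_cone lam m l C b"
  \<comment> \<open>Pullback of the cone to coefficient matrices. It contains the kernel of
    \<open>quad_poly\<close>, so a form nonnegative on it vanishes on that kernel and descends to
    polynomials.\<close>
  define S where "S = {M. quad_poly M \<in> ?K}"
  define E :: "real^('q \<times> 'n \<times> 'n) option^('q \<times> 'n \<times> 'n) option"
    where "E = axis None (axis None 1)"
  have quad_E: "quad_poly (c *\<^sub>R E) = const_poly c" for c
    by (simp add: E_def quad_poly_scale quad_poly_single)
  have S_add: "M + M' \<in> S" if "M \<in> S" "M' \<in> S" for M M'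
    using that by (simp add: S_def quad_poly_add truncated_cone_add)
  have S_scale: "c *\<^sub>R M \<in> S" if "M \<in> S" "0 \<le> c" for M c
    using that by (simp add: S_def quad_poly_scale truncated_cone_scale)
  have "convex S" by (intro convexI S_add S_scale)
  have "0 \<in> S"
    using quad_E[of 0] truncated_cone_ideal[OF ideal2_zero] by (simp add: S_def)
  have "{- E} \<inter> S = {}"
    using notin quad_E[of "- 1"] by (auto simp: S_def const_poly_uminus)
  then obtain A \<beta> where "A \<noteq> 0" and A1: "A \<bullet> (- E) \<le> \<beta>" and A2: "\<And>M. M \<in> S \<Longrightarrow> \<beta> \<le> A \<bullet> M"
    using separating_hyperplane_sets[of "{- E}" S] \<open>convex S\<close> \<open>0 \<in> S\<close> by fastforce
  have "\<beta> \<le> 0" using A2[OF \<open>0 \<in> S\<close>] by simp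
  have A_nonneg: "0 \<le> A \<bullet> M" if "M \<in> S" for M
  proof (rule ccontr)
    assume neg: "\<not> 0 \<le> A \<bullet> M"
    \<comment> \<open>If M had a negative value, this multiple of M would have value \<beta> - 1,
      below the separating bound.\<close>
    define c where "c = (\<beta> - 1) / (A \<bullet> M)"
    have "0 \<le> c" using neg \<open>\<beta> \<le> 0\<close> by (simp add: c_def divide_nonpos_neg)
    from A2[OF S_scale[OF that this]] neg show False by (simp add: c_def)
  qed
  have A_axis: "A \<bullet> axis x (axis y r) = A $ x $ y * r" for x y r
    by (simp add: inner_axis)
  define \<alpha> where "\<alpha> = A $ None $ None"
  have A_E: "A \<bullet> E = \<alpha>" by (simp add: E_def A_axis \<alpha>_def)
  have "0 \<le> \<alpha>" using A1 \<open>\<beta> \<le> 0\<close> by (simp add: A_E)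
  moreover have "\<alpha> \<noteq> 0"
  proof
    assume "\<alpha> = 0"
    \<comment> \<open>With \<alpha> = 0 the constant N contributes nothing to the pairing, so the
      order unit bounds become sign conditions on single entries of A, for both signs.\<close>
    have "0 \<le> e * A $ x $ y" if "e = 1 \<or> e = - 1" for e x y
    proof -
      obtain N where "const_poly N + const_poly e * (basis_poly x * basis_poly y) \<in> ?K"
        using product_bounded[OF \<open>e = 1 \<or> e = - 1\<close>] by blast
      then have "N *\<^sub>R E + axis x (axis y e) \<in> S"
        by (simp add: S_def quad_poly_add quad_E quad_poly_single)
      from A_nonneg[OF this] show ?thesis
        by (simp add: inner_add_right A_E A_axis \<open>\<alpha> = 0\<close> mult.commute)
    qed
    from this[of 1] this[of "- 1"] have "A $ x $ y = 0" for x y by (simp add: antisym)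
    then have "A = 0" by (simp add: vec_eq_iff)
    with \<open>A \<noteq> 0\<close> show False ..
  qed
  ultimately have "0 < \<alpha>" by simp
  \<comment> \<open>The ideal part is a linear subspace, so nonnegativity at both M and -M leaves
    equality.\<close>
  have A_eq_0: "A \<bullet> M = 0" if "quad_poly M \<in> ideal2 lam m l C b" for M
  proof -
    have "M \<in> S" using that by (simp add: S_def truncated_cone_ideal)
    moreover have "- M \<in> S"
      using that quad_poly_scale[of "- 1" M]
      by (simp add: S_def const_poly_uminus ideal2_uminus truncated_cone_ideal)
    ultimately show ?thesis using A_nonneg[of M] A_nonneg[of "- M"] by simp
  qed
  have resp: "A $ x $ y / \<alpha> = A $ x' $ y' / \<alpha>"
    if "basis_poly x * basis_poly y = basis_poly x' * basis_poly y'" for x y x' y'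
  proof -
    \<comment> \<open>The difference of two representations of one product represents the zero
      polynomial, which lies in the ideal.\<close>
    have "quad_poly (axis x (axis y 1) + axis x' (axis y' (- 1))) = 0"
      using that by (simp add: quad_poly_add quad_poly_single const_poly_uminus)
    then have "A \<bullet> (axis x (axis y 1) + axis x' (axis y' (- 1))) = 0"
      by (intro A_eq_0) (simp add: ideal2_zero)
    then show ?thesis by (simp add: inner_add_right A_axis)
  qed
  obtain L :: "('q, 'n) zpoly \<Rightarrow> real" where L: "linear_functional L"
    and LB: "\<And>x y. L (basis_poly x * basis_poly y) = A $ x $ y / \<alpha>"
    using functional_with_moments[of "\<lambda>x y. A $ x $ y / \<alpha>", OF resp] by blast
  have L_quad: "L (quad_poly M) = (A \<bullet> M) / \<alpha>" for M
    by (simp add: linear_functional_quad_poly[OF L] LB inner_vec_def sum_divide_distrib mult.commute)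
  have "L 1 = 1" using LB[of None None] \<open>0 < \<alpha>\<close> by (simp add: \<alpha>_def)
  moreover have "L p = 0" if p: "p \<in> ideal2 lam m l C b" for p
  proof -
    obtain M where "p = quad_poly M" using quadratic_obtain_quad[OF ideal2_degree[OF p]] .
    then show ?thesis using p A_eq_0 by (simp add: L_quad)
  qed
  moreover have "0 \<le> L (g\<^sup>2)" if "affine_poly g" for g
  proof -
    obtain c where "g = lin_poly c" using affine_poly_obtain_lin[OF \<open>affine_poly g\<close>] .
    then obtain M where M: "g\<^sup>2 = quad_poly M" by (auto simp: power2_eq_square lin_poly_mult)
    then have "M \<in> S" by (simp add: S_def M[symmetric] truncated_cone_sos sos_square)
    then show ?thesis using A_nonneg \<open>0 < \<alpha>\<close> by (simp add: M L_quad)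
  qed
  ultimately show ?thesis using L by (auto simp: feasible_functional_def)
qed

subsection \<open>From functionals to the relaxation\<close>

text \<open>The two halves add up to 1 when s = t, so one formula covers both cases of the
  definition.\<close>

lemma fmat_nth: "fmat s t $ k $ r =
  (if k = s then 1 else 0) * (if r = t then 1 / 2 else 0) +
  (if k = t then 1 else 0) * (if r = s then 1 / 2 else 0)"
  by (auto simp: fmat_def outer_def axis_def)

text \<open>Pairing with \<open>fmat s t\<close> evaluates the symmetrised array at (s,t). This is
  how entries are read off from trace identities whose multipliers must be symmetric.\<close>

lemma sum_fmat:
  "(\<Sum>k\<in>UNIV. \<Sum>r\<in>UNIV. fmat s t $ k $ r * g k r) = (g s t + g t s) / (2 :: real)"
proof -
  have "(\<Sum>k\<in>UNIV. \<Sum>r\<in>UNIV. fmat s t $ k $ r * g k r)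
    = (\<Sum>k\<in>UNIV. \<Sum>r\<in>UNIV. if r = t then if k = s then g s t / 2 else 0 else 0)
    + (\<Sum>k\<in>UNIV. \<Sum>r\<in>UNIV. if r = s then if k = t then g t s / 2 else 0 else 0)"
    unfolding sum.distrib[symmetric] by (intro sum.cong refl) (auto simp: fmat_nth)
  then show ?thesis by (simp add: add_divide_distrib)
qed

lemma fmat_commute: "fmat s t = fmat t s"
  by (simp add: vec_eq_iff fmat_nth)

lemma sym_mats_iff: "A \<in> sym_mats \<longleftrightarrow> (\<forall>s t. A $ s $ t = A $ t $ s)"
  by (auto simp: sym_mats_def transpose_def vec_eq_iff)

lemma sym_matsD: "A \<in> sym_mats \<Longrightarrow> A $ s $ t = A $ t $ s"
  by (simp add: sym_mats_iff)

lemma fmat_sym [simp]: "fmat s t \<in> sym_mats"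
  by (auto simp: sym_mats_iff fmat_nth)

text \<open>The relations are tested against admissible multipliers: \<open>p\<close> times
  \<open>fmat s t\<close> for \<open>f1\<close>, \<open>fmat s t\<close> for \<open>f3\<close>, and
  \<open>p\<close> for the scalar ones. With p = 1 they give linear constraints on the Z_i, with p
  an indeterminate the corresponding constraints on the operators W_{i,j}.\<close>

lemma feasible_functional_relations:
  fixes C :: "nat \<Rightarrow> real^'n^'n" and lam :: "'q::finite \<Rightarrow> real"
  assumes L: "feasible_functional lam m l C b L"
  shows feasible_functional_f1: "affine_poly p \<Longrightarrow>
      (\<Sum>i\<in>UNIV. L (p * var_poly i s t)) = (if s = t then 1 else 0) * L p"
    and feasible_functional_f2: "affine_poly p \<Longrightarrow>
      (\<Sum>s\<in>UNIV. L (p * var_poly i s s)) = real (m i) * L p"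
    and feasible_functional_f3:
      "(\<Sum>r\<in>UNIV. L (var_poly i s r * var_poly i r t)) = L (var_poly i s t)"
    and feasible_functional_f4: "affine_poly p \<Longrightarrow> k \<in> {1..l} \<Longrightarrow>
      (\<Sum>i\<in>UNIV. lam i * (\<Sum>s\<in>UNIV. \<Sum>t\<in>UNIV. C k $ s $ t * L (p * var_poly i s t))) = b k * L p"
proof -
  have lin: "linear_functional L" and zero: "\<And>f. f \<in> ideal2 lam m l C b \<Longrightarrow> L f = 0"
    using L by (auto simp: feasible_functional_def)
  note Ls = linear_functional_simps[OF lin]
  have Lr: "L (p * const_poly c) = c * L p" for p c
    using linear_functional_const_mult[OF lin, of c p] by (simp add: mult.commute)
  { assume p: "affine_poly p"
    define h :: "('q, 'n) zpoly^'n^'n" where "h = (\<chi> k r. const_poly (fmat s t $ k $ r) * p)"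
    have "transpose h = h"
      by (simp add: h_def transpose_def vec_eq_iff) (metis fmat_sym sym_matsD)
    then have "0 = L (trace (h ** f1))"
      using p zero ideal2_f1[of h lam m l C b]
      by (simp add: h_def affine_poly_iff_degree poly_degree_le_const_mult)
    also have "\<dots> = (\<Sum>k\<in>UNIV. \<Sum>r\<in>UNIV. fmat s t $ k $ r * L (p * f1 $ r $ k))"
      by (simp add: trace_mult h_def Ls mult.assoc)
    also have "\<dots> = (L (p * f1 $ t $ s) + L (p * f1 $ s $ t)) / 2" by (rule sum_fmat)
    \<comment> \<open>A symmetric multiplier sees only the average of the entries at (s,t) and
      (t,s); symmetry of the relation recovers the entry itself.\<close>
    also have "f1 $ t $ s = (f1 $ s $ t :: ('q, 'n) zpoly)"
      by (simp add: f1_nth var_poly_commute[of _ t s])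
    finally have "L (p * f1 $ s $ t) = 0" by simp
    then show "(\<Sum>i\<in>UNIV. L (p * var_poly i s t)) = (if s = t then 1 else 0) * L p"
      by (simp add: f1_nth right_diff_distrib sum_distrib_left Ls Lr del: const_poly_0 const_poly_1) }
  { assume "affine_poly p"
    from zero[OF ideal2_f2[OF this]] show "(\<Sum>s\<in>UNIV. L (p * var_poly i s s)) = real (m i) * L p"
      by (simp add: f2_expand right_diff_distrib sum_distrib_left Ls Lr) }
  { have "0 = L (trace (const_mat (fmat s t) ** f3 i))"
      using zero[OF ideal2_f3[OF fmat_sym]] by simp
    also have "\<dots> = (\<Sum>k\<in>UNIV. \<Sum>r\<in>UNIV. fmat s t $ k $ r * L (f3 i $ r $ k))"
      by (simp add: trace_mult Ls)
    also have "\<dots> = (L (f3 i $ t $ s) + L (f3 i $ s $ t)) / 2" by (rule sum_fmat)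
    also have "f3 i $ t $ s = (f3 i $ s $ t :: ('q, 'n) zpoly)"
    proof -
      have "var_poly i t r * var_poly i r s = var_poly i s r * (var_poly i r t :: ('q, 'n) zpoly)" for r
        by (metis mult.commute var_poly_commute)
      then show ?thesis by (simp add: f3_nth var_poly_commute[of _ t s])
    qed
    finally show "(\<Sum>r\<in>UNIV. L (var_poly i s r * var_poly i r t)) = L (var_poly i s t)"
      by (simp add: f3_nth Ls) }
  { assume "affine_poly p" "k \<in> {1..l}"
    from zero[OF ideal2_f4[OF this]]
    have "L (p * f4 lam C b k) = 0" .
    moreover have "p * f4 lam C b k = (\<Sum>i\<in>UNIV. const_poly (lam i) *
        (\<Sum>s\<in>UNIV. \<Sum>t\<in>UNIV. const_poly (C k $ s $ t) * (p * var_poly i s t))) - p * const_poly (b k)"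
      by (simp add: f4_expand right_diff_distrib sum_distrib_left mult.left_commute)
    ultimately show "(\<Sum>i\<in>UNIV. lam i * (\<Sum>s\<in>UNIV. \<Sum>t\<in>UNIV. C k $ s $ t * L (p * var_poly i s t)))
        = b k * L p"
      by (simp add: Ls Lr) }
qed

text \<open>Converse of the preceding extraction: an element of the ideal is a sum of entries of the
  relations times admissible multipliers, and the four identities say that \<open>L\<close> kills
  each summand.\<close>

lemma ideal2_annihilated:
  fixes C :: "nat \<Rightarrow> real^'n^'n" and lam :: "'q::finite \<Rightarrow> real"
  assumes lin: "linear_functional L"
    and 1: "\<And>p s t. affine_poly p \<Longrightarrow>
      (\<Sum>i\<in>UNIV. L (p * var_poly i s t)) = (if s = t then 1 else 0) * L p"
    and 2: "\<And>p i. affine_poly p \<Longrightarrow>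
      (\<Sum>s\<in>UNIV. L (p * var_poly i s s)) = real (m i) * L p"
    and 3: "\<And>i s t. (\<Sum>r\<in>UNIV. L (var_poly i s r * var_poly i r t)) = L (var_poly i s t)"
    and 4: "\<And>p k. affine_poly p \<Longrightarrow> k \<in> {1..l} \<Longrightarrow>
      (\<Sum>i\<in>UNIV. lam i * (\<Sum>s\<in>UNIV. \<Sum>t\<in>UNIV. C k $ s $ t * L (p * var_poly i s t))) = b k * L p"
    and p: "p \<in> ideal2 lam m l C b"
  shows "L p = 0"
proof -
  note Ls = linear_functional_simps[OF lin]
  have Lr: "L (p * const_poly c) = c * L p" for p c
    using linear_functional_const_mult[OF lin, of c p] by (simp add: mult.commute)
  obtain h1 h2 h3 h4 where h:
      "\<And>s t. affine_poly (h1 $ s $ t)" "\<And>i. affine_poly (h2 i)"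
      "\<And>k. k \<in> {1..l} \<Longrightarrow> affine_poly (h4 k)"
    and p: "p = trace (h1 ** f1)
            + (\<Sum>i\<in>UNIV. h2 i * f2 m i + trace (const_mat (h3 i) ** f3 i))
            + (\<Sum>k\<in>{1..l}. h4 k * f4 lam C b k)"
    using p unfolding ideal2_def by blast
  have "L (r * f1 $ s $ t) = 0" if "affine_poly r" for r s t
    using 1[OF that]
    by (simp add: f1_nth right_diff_distrib sum_distrib_left Ls Lr del: const_poly_0 const_poly_1)
  then have "L (trace (h1 ** f1)) = 0" by (simp add: trace_mult Ls h)
  moreover have "L (r * f2 m i) = 0" if "affine_poly r" for r i
    using 2[OF that] by (simp add: f2_expand right_diff_distrib sum_distrib_left Ls Lr)
  moreover have "L (trace (const_mat A ** f3 i)) = 0" for A i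
    by (simp add: trace_mult Ls f3_nth 3)
  moreover have "L (r * f4 lam C b k) = 0" if r: "affine_poly r" and k: "k \<in> {1..l}" for r k
  proof -
    have "r * f4 lam C b k = (\<Sum>i\<in>UNIV. const_poly (lam i) *
        (\<Sum>s\<in>UNIV. \<Sum>t\<in>UNIV. const_poly (C k $ s $ t) * (r * var_poly i s t))) - r * const_poly (b k)"
      by (simp add: f4_expand right_diff_distrib sum_distrib_left mult.left_commute)
    then show ?thesis using 4[OF r k] by (simp add: Ls Lr)
  qed
  ultimately show ?thesis by (simp add: p Ls h)
qed

section \<open>The trace form as the entrywise inner product\<close>

lemma trace_eq_inner: "B \<in> sym_mats \<Longrightarrow> trace (A ** B) = A \<bullet> B"
  unfolding trace_mult inner_vec_def by (intro sum.cong refl) (simp add: sym_matsD[of B])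

lemma tuple_inner_eq_inner: "Y \<in> sym_tuples \<Longrightarrow> tuple_inner X Y = X \<bullet> Y"
  by (simp add: tuple_inner_def sym_tuples_def trace_eq_inner inner_vec_def[of X])

lemma fmat_inner: "A \<in> sym_mats \<Longrightarrow> fmat s t \<bullet> A = A $ s $ t"
  using sum_fmat[of s t "\<lambda>k r. A $ k $ r"] by (simp add: inner_vec_def sym_matsD[of A t s])

lemma relax2_nonempty:
  fixes C :: "nat \<Rightarrow> real^'n^'n" and lam :: "'q::finite \<Rightarrow> real"
  assumes L: "feasible_functional lam m l C b L"
  shows "relax2 lam m l C b \<noteq> {}"
proof -
  have lin: "linear_functional L" and L1: "L 1 = 1"
    and sq: "\<And>g. affine_poly g \<Longrightarrow> 0 \<le> L (g\<^sup>2)"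
    using L by (auto simp: feasible_functional_def)
  note Ls = linear_functional_simps[OF lin]
  note rel = feasible_functional_relations[OF L]
  have aff: "affine_poly (var_poly i s t)" "affine_poly 1" for i s t
    by (simp_all add: affine_poly_iff_degree)
  define Z :: "real^'n^'n^'q" where "Z = (\<chi> i s t. L (var_poly i s t))"
  \<comment> \<open>Its (s,t) entry is \<open>L\<close> applied to (Z_i)_{s,t} times the linear form
    <X, Z_j>, so the values on \<open>fmat k r\<close> are plain second moments.\<close>
  define W where "W i j X = (\<chi> s t. \<Sum>k\<in>UNIV. \<Sum>r\<in>UNIV. X $ k $ r * L (var_poly i s t * var_poly j k r))"
    for i j and X :: "real^'n^'n"
  define T where "T X = (\<chi> i. \<Sum>j\<in>UNIV. W i j (X $ j))" for X
  \<comment> \<open>The linear form of a tuple X. The pairing of Y with \<open>T X\<close> is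
    \<open>L (P Y * P X)\<close>, so positivity of the operator is nonnegativity of \<open>L\<close>
    on squares of linear forms.\<close>
  define P :: "real^'n^'n^'q \<Rightarrow> ('q, 'n) zpoly"
    where "P X = (\<Sum>i\<in>UNIV. \<Sum>s\<in>UNIV. \<Sum>t\<in>UNIV. const_poly (X $ i $ s $ t) * var_poly i s t)" for X
  have Zsym: "Z $ i \<in> sym_mats" for i
    by (simp add: sym_mats_iff Z_def var_poly_commute)
  have Wsym: "W i j X \<in> sym_mats" for i j X
    by (simp add: sym_mats_iff W_def var_poly_commute)
  have sumsym: "sum f A \<in> sym_mats" if "\<And>x. x \<in> A \<Longrightarrow> f x \<in> sym_mats" for f :: "'q \<Rightarrow> real^'n^'n" and A
    using that by (simp add: sym_mats_iff)
  have Tsym: "T X \<in> sym_tuples" for X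
    by (simp add: sym_tuples_def T_def sumsym Wsym)
  have W_add: "W i j (X + Y) = W i j X + W i j Y" for i j X Y
    by (simp add: W_def vec_eq_iff distrib_right sum.distrib)
  have W_scale: "W i j (c *\<^sub>R X) = c *\<^sub>R W i j X" for i j c X
    by (simp add: W_def vec_eq_iff sum_distrib_left mult.assoc)
  have W_fmat: "W i j (fmat k r) $ s $ t = L (var_poly i s t * var_poly j k r)" for i j k r s t
    by (simp add: W_def sum_fmat var_poly_commute[of j r k])
  have T_nth: "T X $ i $ s $ t = L (var_poly i s t * P X)" for X i s t
    by (simp add: T_def W_def P_def sum_distrib_left mult.left_commute[of "var_poly _ _ _" "const_poly _"] Ls)
  have T_inner: "T X \<bullet> Y = L (P Y * P X)" for X Y
    by (simp add: inner_vec_def T_nth P_def[of Y] sum_distrib_right mult.assoc Ls mult.commute[of "L _"])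
  have P_aff: "affine_poly (P X)" for X
    unfolding P_def affine_poly_iff_degree
    by (intro poly_degree_le_sum poly_degree_le_const_mult) simp
  have W_lin: "lin_op_on sym_mats (W i j)" for i j
    by (simp add: lin_op_on_def Wsym W_add W_scale)
  have T_lin: "lin_op_on sym_tuples T"
    by (simp add: lin_op_on_def Tsym) (simp add: T_def vec_eq_iff W_add W_scale sum.distrib sum_distrib_left)
  have T_psd: "psd_op T"
    unfolding psd_op_def using sq[OF P_aff]
    by (auto simp: tuple_inner_eq_inner Tsym T_inner inner_commute[of _ "T _"] mult.commute power2_eq_square)
  have Z_psd: "psd_mat (Z $ i)" for i
  proof -
    have "0 \<le> v \<bullet> (Z $ i *v v)" for v
    proof -
      \<comment> \<open>\<open>q r\<close> is the r-th entry of Z_i v for the matrix of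
        indeterminates. As \<open>L\<close> identifies Z_i^2 with Z_i entrywise, the values of
        \<open>L\<close> on the squares of the \<open>q r\<close> add up to v^T L(Z_i) v.\<close>
      define q where "q r = (\<Sum>s\<in>UNIV. const_poly (v $ s) * var_poly i s r :: ('q, 'n) zpoly)" for r
      have "affine_poly (q r)" for r
        unfolding q_def affine_poly_iff_degree
        by (intro poly_degree_le_sum poly_degree_le_const_mult) simp
      have "L ((q r)\<^sup>2) = (\<Sum>s\<in>UNIV. \<Sum>t\<in>UNIV. v $ s * (v $ t * L (var_poly i s r * var_poly i r t)))" for r
      proof -
        have "(q r)\<^sup>2 = (\<Sum>s\<in>UNIV. \<Sum>t\<in>UNIV. const_poly (v $ s) * (const_poly (v $ t) * (var_poly i s r * var_poly i r t)))"
          unfolding power2_eq_square q_def sum_product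
          by (intro sum.cong refl) (simp add: ac_simps var_poly_commute[of i r])
        then show ?thesis by (simp add: Ls)
      qed
      then have "(\<Sum>r\<in>UNIV. L ((q r)\<^sup>2))
        = (\<Sum>s\<in>UNIV. \<Sum>t\<in>UNIV. \<Sum>r\<in>UNIV. v $ s * (v $ t * L (var_poly i s r * var_poly i r t)))"
        by (simp only:) (subst sum.swap, intro sum.cong refl sum.swap)
      also have "\<dots> = v \<bullet> (Z $ i *v v)"
        by (simp add: sum_distrib_left[symmetric] rel(3) inner_vec_def matrix_vector_mult_def Z_def
            mult.commute[of "L _"])
      finally show ?thesis
        using sq[OF \<open>\<And>r. affine_poly (q r)\<close>] by (metis (no_types, lifting) sum_nonneg)
    qed
    then show ?thesis by (simp add: psd_mat_def Zsym)
  qed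
  have "Z \<in> relax2 lam m l C b"
    unfolding relax2_def mem_Collect_eq
  proof (intro conjI exI[of _ W] exI[of _ T] allI ballI)
    show "Z \<in> sym_tuples" by (simp add: sym_tuples_def Zsym)
    show "T X $ i = (\<Sum>j\<in>UNIV. W i j (X $ j))" for X i by (simp add: T_def)
    show "(\<Sum>i\<in>UNIV. Z $ i) = mat 1"
      using rel(1)[OF aff(2)] by (simp add: vec_eq_iff Z_def mat_def L1)
    show "trace (Z $ i) = real (m i)" for i
      using rel(2)[OF aff(2)] by (simp add: trace_def Z_def L1)
    show "(\<Sum>i\<in>UNIV. lam i * trace (Z $ i ** C k)) = b k" if "k \<in> {1..l}" for k
    proof -
      have "trace (Z $ i ** C k) = (\<Sum>s\<in>UNIV. \<Sum>t\<in>UNIV. C k $ s $ t * L (1 * var_poly i s t))" for i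
        by (subst trace_mul_sym) (simp add: trace_mult Z_def var_poly_commute)
      then show ?thesis using rel(4)[OF aff(2) that] by (simp add: L1)
    qed
    show "(\<Sum>j\<in>UNIV. W i j (fmat s t)) = (if s = t then 1 else 0) *\<^sub>R Z $ i" for s t i
      using rel(1)[OF aff(1)] by (simp add: vec_eq_iff W_fmat Z_def)
    show "(\<Sum>s\<in>UNIV. W i j (fmat s s)) = real (m j) *\<^sub>R Z $ i" for i j
      using rel(2)[OF aff(1)] by (simp add: vec_eq_iff W_fmat Z_def)
    show "(\<Sum>r\<in>UNIV. trace (fmat s r ** W i i (fmat t r))) = Z $ i $ s $ t" for i s t
      using rel(3)[of i s t]
      by (simp add: trace_eq_inner Wsym fmat_inner W_fmat Z_def var_poly_commute[of _ t])
    show "(\<Sum>j\<in>UNIV. lam j *\<^sub>R W i j (C k)) = b k *\<^sub>R Z $ i" if "k \<in> {1..l}" for i k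
      using rel(4)[OF aff(1) that] by (simp add: vec_eq_iff W_def Z_def)
  qed (use W_lin T_lin T_psd Z_psd in auto)
  then show ?thesis by blast
qed

subsection \<open>From the relaxation to functionals\<close>

lemma subspace_sym_mats: "subspace (sym_mats :: (real^'n^'n) set)"
  by (auto simp: subspace_def sym_mats_iff)

lemma subspace_sym_tuples: "subspace (sym_tuples :: (real^'n^'n^'q) set)"
  using subspace_sym_mats by (auto simp: subspace_def sym_tuples_def)

text \<open>Linearity holds only on \<open>S\<close>, so the induction must keep every term and
  every partial sum inside \<open>S\<close>.\<close>

lemma lin_op_on_sum:
  assumes f: "lin_op_on S f" and S: "subspace S" and x: "\<And>i. i \<in> I \<Longrightarrow> x i \<in> S"
  shows "f (\<Sum>i\<in>I. c i *\<^sub>R x i) = (\<Sum>i\<in>I. c i *\<^sub>R f (x i))"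
proof -
  have f0: "f 0 = 0"
  proof -
    have "f (0 *\<^sub>R 0) = 0 *\<^sub>R f 0"
      using f subspace_0[OF S] unfolding lin_op_on_def by blast
    then show ?thesis by simp
  qed
  show ?thesis
    using x
  proof (induction I rule: infinite_finite_induct)
    case (insert i I)
    have mem: "c i *\<^sub>R x i \<in> S" "(\<Sum>i\<in>I. c i *\<^sub>R x i) \<in> S"
      using S insert.prems by (auto intro: subspace_scale subspace_sum)
    have "f (\<Sum>i\<in>insert i I. c i *\<^sub>R x i) = f (c i *\<^sub>R x i + (\<Sum>i\<in>I. c i *\<^sub>R x i))"
      using insert.hyps by simp
    also have "\<dots> = f (c i *\<^sub>R x i) + f (\<Sum>i\<in>I. c i *\<^sub>R x i)"
      using f mem unfolding lin_op_on_def by blast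
    also have "f (c i *\<^sub>R x i) = c i *\<^sub>R f (x i)"
      using f insert.prems unfolding lin_op_on_def by blast
    finally show ?case using insert by simp
  qed (simp_all add: f0)
qed

lemma sum_fmat_diag: "(\<Sum>s\<in>UNIV. fmat s s) = mat 1"
proof -
  have "(\<Sum>s\<in>UNIV. fmat s s $ k $ r) = (\<Sum>s\<in>UNIV. if s = k then if k = r then 1 else 0 else 0)"
    for k r :: 'a
    by (intro sum.cong refl) (auto simp: fmat_nth)
  then show ?thesis by (simp add: vec_eq_iff mat_def)
qed

text \<open>Ordered pairs count each off-diagonal position twice, which offsets the factor 1/2 in
  \<open>fmat\<close>.\<close>

lemma sym_mat_expand:
  assumes "A \<in> sym_mats"
  shows "A = (\<Sum>v\<in>UNIV. A $ fst v $ snd v *\<^sub>R fmat (fst v) (snd v))"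
proof -
  have "(\<Sum>v\<in>UNIV. A $ fst v $ snd v *\<^sub>R fmat (fst v) (snd v)) $ k $ r = A $ k $ r" for k r
  proof -
    have "(\<Sum>v\<in>UNIV. A $ fst v $ snd v *\<^sub>R fmat (fst v) (snd v)) $ k $ r
      = (\<Sum>s\<in>UNIV. \<Sum>t\<in>UNIV. A $ s $ t * fmat s t $ k $ r)"
      by (simp add: sum.cartesian_product case_prod_beta UNIV_Times_UNIV)
    \<comment> \<open>The entry of \<open>fmat s t\<close> at (k,r) equals that of
      \<open>fmat k r\<close> at (s,t), which turns the sum into a pairing with a single
      \<open>fmat\<close>.\<close>
    also have "\<dots> = (\<Sum>s\<in>UNIV. \<Sum>t\<in>UNIV. fmat k r $ s $ t * A $ s $ t)"
      by (intro sum.cong refl) (auto simp: fmat_nth)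
    also have "\<dots> = A $ k $ r"
      using sym_matsD[OF assms, of r k] by (simp add: sum_fmat)
    finally show ?thesis .
  qed
  then show ?thesis by (simp add: vec_eq_iff)
qed

section \<open>Unique factorisation of monomials of degree at most two\<close>

lemma single_add_single_eq:
  fixes u v u' v' :: 'a
  assumes "Poly_Mapping.single u (1::nat) + Poly_Mapping.single v 1
     = Poly_Mapping.single u' 1 + Poly_Mapping.single v' 1"
  shows "(u = u' \<and> v = v') \<or> (u = v' \<and> v = u')"
proof -
  have "Poly_Mapping.lookup (Poly_Mapping.single u (1::nat) + Poly_Mapping.single v 1) x
     = Poly_Mapping.lookup (Poly_Mapping.single u' 1 + Poly_Mapping.single v' 1) x" for x
    using assms by simp
  from this[of u] this[of v] this[of u'] show ?thesis
    by (auto simp: lookup_add lookup_single when_def split: if_splits)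
qed

text \<open>Commutativity is the only coincidence among products of two basis monomials. A symmetric
  form that depends on its indices only through their monomials therefore defines consistent
  moments.\<close>

lemma basis_mono_add_eq:
  assumes "basis_mono a + basis_mono b = basis_mono a' + basis_mono b'"
  shows "(basis_mono a = basis_mono a' \<and> basis_mono b = basis_mono b') \<or>
    (basis_mono a = basis_mono b' \<and> basis_mono b = basis_mono a')"
proof -
  have cases: "basis_mono x = 0 \<or> (\<exists>v. basis_mono x = Poly_Mapping.single v 1)"
    for x :: "('a \<times> 'b \<times> 'b) option"
    by (auto simp: basis_mono_def split: option.split)
  have deg: "mono_degree (basis_mono a) + mono_degree (basis_mono b)
      = mono_degree (basis_mono a') + mono_degree (basis_mono b')"
    using assms by (metis mono_degree_add)
  show ?thesis
  proof (cases "basis_mono a = 0 \<or> basis_mono b = 0 \<or> basis_mono a' = 0 \<or> basis_mono b' = 0")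
    case True
    then show ?thesis
      using cases[of a] cases[of b] cases[of a'] cases[of b'] deg assms
      by (elim disjE exE) simp_all
  next
    case False
    then obtain u v u' v' where "basis_mono a = Poly_Mapping.single u 1"
        "basis_mono b = Poly_Mapping.single v 1" "basis_mono a' = Poly_Mapping.single u' 1"
        "basis_mono b' = Poly_Mapping.single v' 1"
      using cases by metis
    then show ?thesis using assms single_add_single_eq[of u v u' v'] by auto
  qed
qed

text \<open>Put $u = \frac1n (I, \dots, I)$. The constraints of the relaxation give
  $\mathfrak{W}(u) = (Z_1, \dots, Z_q)$ and $\langle u, \mathfrak{W}(u)\rangle = 1$, so the Gram matrix
  of $u$ and the tuples with one entry $f_{s,t}$ under the form
  $\langle X, \mathfrak{W}(Y)\rangle$ is the full moment matrix, with $u$ in the role of the constant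
  polynomial 1.\<close>

lemma feasible_functional_of_relax2:
  fixes C :: "nat \<Rightarrow> real^'n^'n" and lam :: "'q::finite \<Rightarrow> real"
  assumes sum_m: "(\<Sum>i\<in>UNIV. m i) = CARD('n)"
    and Csym: "\<And>k. k \<in> {1..l} \<Longrightarrow> C k \<in> sym_mats"
    and Z: "Z \<in> relax2 lam m l C b"
  shows "\<exists>L. feasible_functional lam m l C b L"
proof -
  obtain W T where rel:
    "\<forall>i j. lin_op_on sym_mats (W i j)" "lin_op_on sym_tuples T" "psd_op T"
    "\<forall>X\<in>sym_tuples. \<forall>i. T X $ i = (\<Sum>j\<in>UNIV. W i j (X $ j))"
    "\<forall>i. trace (Z $ i) = real (m i)"
    "\<forall>s t i. (\<Sum>j\<in>UNIV. W i j (fmat s t)) = (if s = t then 1 else 0) *\<^sub>R Z $ i"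
    "\<forall>i j. (\<Sum>s\<in>UNIV. W i j (fmat s s)) = real (m j) *\<^sub>R Z $ i"
    "\<forall>i s t. (\<Sum>r\<in>UNIV. trace (fmat s r ** W i i (fmat t r))) = Z $ i $ s $ t"
    "\<forall>i. \<forall>k\<in>{1..l}. (\<Sum>j\<in>UNIV. lam j *\<^sub>R W i j (C k)) = b k *\<^sub>R Z $ i"
    using Z unfolding relax2_def mem_Collect_eq by (elim conjE exE) (rule that; assumption)
  note Wlin = rel(1)[rule_format] and Tlin = rel(2) and psd = rel(3) and TW = rel(4)[rule_format]
    and Ztr = rel(5)[rule_format] and W1 = rel(6)[rule_format] and W2 = rel(7)[rule_format]
    and W3 = rel(8)[rule_format] and W4 = rel(9)[rule_format]
  have Zsym: "Z $ i \<in> sym_mats" for i using Z by (simp add: relax2_def sym_tuples_def)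
  have Wsym: "W i j X \<in> sym_mats" if "X \<in> sym_mats" for i j X
    using Wlin that unfolding lin_op_on_def by blast
  have Tsym: "T X \<in> sym_tuples" if "X \<in> sym_tuples" for X
    using Tlin that unfolding lin_op_on_def by blast
  have W0: "W i j 0 = 0" for i j
    using lin_op_on_sum[OF Wlin subspace_sym_mats, of "{}" "\<lambda>_. 0"] by simp
  define u :: "real^'n^'n^'q" where "u = (\<chi> i. (1 / real CARD('n)) *\<^sub>R mat 1)"
  define F :: "('q \<times> 'n \<times> 'n) option \<Rightarrow> real^'n^'n^'q"
    where "F a = (case a of None \<Rightarrow> u | Some (i, s, t) \<Rightarrow> axis i (fmat s t))" for a
  have F_simps [simp]: "F None = u" "F (Some (i, s, t)) = axis i (fmat s t)" for i s t
    by (simp_all add: F_def)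
  have Fsym: "F a \<in> sym_tuples" for a
  proof (cases a)
    case None
    then show ?thesis
      by (auto simp: sym_tuples_def u_def sym_mats_iff mat_def)
  next
    case (Some v)
    then show ?thesis
      by (cases v) (auto simp: sym_tuples_def axis_def sym_mats_iff[of 0])
  qed
  have Tu: "T u = Z"
  proof -
    have "T u $ i = (\<Sum>j\<in>UNIV. W i j (\<Sum>s\<in>UNIV. (1 / real CARD('n)) *\<^sub>R fmat s s))" for i
      using TW[of u i] Fsym[of None]
      by (simp add: u_def sum_fmat_diag[symmetric] scaleR_sum_right)
    also have "\<dots> i = (\<Sum>j\<in>UNIV. (1 / real CARD('n)) *\<^sub>R (\<Sum>s\<in>UNIV. W i j (fmat s s)))" for i
      by (simp add: lin_op_on_sum[OF Wlin subspace_sym_mats] scaleR_sum_right)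
    \<comment> \<open>Each j contributes m_j / n times Z_i, and the multiplicities add up to n; this
      fixes the factor 1/n in \<open>u\<close>.\<close>
    also have "\<dots> i = (real (\<Sum>j\<in>UNIV. m j) / real CARD('n)) *\<^sub>R Z $ i" for i
      by (simp add: W2 scaleR_left.sum[symmetric] sum_divide_distrib[symmetric])
    finally show ?thesis by (simp add: vec_eq_iff sum_m)
  qed
  have T_axis: "T (axis i (fmat s t)) $ j = W j i (fmat s t)" for i j s t
  proof -
    have "T (axis i (fmat s t)) $ j = (\<Sum>k\<in>UNIV. W j k (axis i (fmat s t) $ k))"
      using TW[OF Fsym[of "Some (i, s, t)"]] by simp
    also have "\<dots> = (\<Sum>k\<in>UNIV. if k = i then W j i (fmat s t) else 0)"
      by (intro sum.cong refl) (simp add: axis_def W0)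
    finally show ?thesis by simp
  qed
  define B where "B a c = F a \<bullet> T (F c)" for a c
  have B_commute: "B a c = B c a" for a c
  proof -
    have "tuple_inner (T (F a)) (F c) = tuple_inner (F a) (T (F c))"
      using psd Fsym unfolding psd_op_def by blast
    then have "T (F a) \<bullet> F c = F a \<bullet> T (F c)"
      by (simp only: tuple_inner_eq_inner Fsym Tsym)
    then show ?thesis by (simp add: B_def inner_commute)
  qed
  \<comment> \<open>Indices with the same monomial differ at most by exchanging s and t, and
    \<open>fmat\<close> is symmetric in its two indices.\<close>
  have F_mono: "F a = F c" if "basis_mono a = basis_mono c" for a c
  proof -
    have "Poly_Mapping.single v (Suc 0) = Poly_Mapping.single w (Suc 0) \<longleftrightarrow> v = w"
        "Poly_Mapping.single v (Suc 0) \<noteq> 0" for v w :: "'q \<times> 'n uprod"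
      by (metis keys_single nat.distinct(1) singleton_inject)
        (metis mono_degree_0 mono_degree_single nat.distinct(1))
    then show ?thesis
      using that by (auto simp: F_def basis_mono_def fmat_commute dest: sym split: option.splits)
  qed
  have B_resp: "B a c = B a' c'"
    if "basis_poly a * basis_poly c = basis_poly a' * basis_poly c'" for a c a' c'
  proof -
    have "(F a = F a' \<and> F c = F c') \<or> (F a = F c' \<and> F c = F a')"
      using basis_mono_add_eq[of a c a' c'] that F_mono basis_poly_mult_eq_iff by metis
    then show ?thesis
      using B_commute by (auto simp: B_def)
  qed
  obtain L :: "('q, 'n) zpoly \<Rightarrow> real" where lin: "linear_functional L"
    and LB: "\<And>a c. L (basis_poly a * basis_poly c) = B a c"
    using functional_with_moments[of B, OF B_resp] by blast
  note Ls = linear_functional_simps[OF lin]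
  have L_lin: "L (lin_poly c * basis_poly a) = (\<Sum>x\<in>UNIV. c x *\<^sub>R F x) \<bullet> T (F a)" for c a
    by (simp add: lin_poly_def sum_distrib_right mult.assoc Ls LB B_def inner_sum_left)
  have L_lin1: "L (lin_poly c) = (\<Sum>x\<in>UNIV. c x *\<^sub>R F x) \<bullet> Z" for c
    using L_lin[of c None] by (simp add: Tu)
  have L_linv: "L (lin_poly c * var_poly i s t) = (\<Sum>x\<in>UNIV. c x *\<^sub>R F x) \<bullet> T (axis i (fmat s t))"
    for c i s t
    using L_lin[of c "Some (i, s, t)"] by simp
  have "L 1 = 1"
  proof -
    have "L 1 = u \<bullet> Z" using LB[of None None] by (simp add: B_def Tu)
    also have "\<dots> = (\<Sum>i\<in>UNIV. u $ i \<bullet> Z $ i)" by (rule inner_vec_def)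
    also have "\<dots> = (\<Sum>i\<in>UNIV. trace (Z $ i)) / real CARD('n)"
    proof -
      have "mat 1 \<bullet> Z $ i = trace (Z $ i)" for i
        using trace_eq_inner[OF Zsym, of "mat 1" i] by simp
      then show ?thesis by (simp add: u_def sum_divide_distrib)
    qed
    also have "\<dots> = real (\<Sum>i\<in>UNIV. m i) / real CARD('n)" by (simp add: Ztr)
    finally show ?thesis by (simp add: sum_m)
  qed
  moreover have "L p = 0" if "p \<in> ideal2 lam m l C b" for p
    using lin _ _ _ _ that
  proof (rule ideal2_annihilated)
    fix p :: "('q, 'n) zpoly" and s t assume "affine_poly p"
    then obtain c where p: "p = lin_poly c" by (rule affine_poly_obtain_lin)
    \<comment> \<open>The constraint becomes an identity between values of \<open>T\<close>. Since
      \<open>L p\<close> is the pairing of a coefficient tuple of p with Z, pairing the identity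
      with that tuple gives the relation for every affine p at once. The trace and affine
      constraints below are treated alike.\<close>
    have "(\<Sum>i\<in>UNIV. T (axis i (fmat s t))) = (if s = t then 1 else 0) *\<^sub>R Z"
      using W1 by (simp add: vec_eq_iff[where 'b = 'q] T_axis)
    then show "(\<Sum>i\<in>UNIV. L (p * var_poly i s t)) = (if s = t then 1 else 0) * L p"
      by (simp only: p L_linv L_lin1 inner_sum_right[symmetric] inner_scaleR_right)
  next
    fix p :: "('q, 'n) zpoly" and i assume "affine_poly p"
    then obtain c where p: "p = lin_poly c" by (rule affine_poly_obtain_lin)
    have "(\<Sum>s\<in>UNIV. T (axis i (fmat s s))) = real (m i) *\<^sub>R Z"
      using W2 by (simp add: vec_eq_iff[where 'b = 'q] T_axis)
    then show "(\<Sum>s\<in>UNIV. L (p * var_poly i s s)) = real (m i) * L p"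
      by (simp only: p L_linv L_lin1 inner_sum_right[symmetric] inner_scaleR_right)
  next
    fix i s t
    have "L (var_poly i s r * var_poly i r t) = trace (fmat s r ** W i i (fmat t r))" for r
    proof -
      have "L (var_poly i s r * var_poly i r t) = axis i (fmat s r) \<bullet> T (axis i (fmat t r))"
        using LB[of "Some (i, s, r)" "Some (i, r, t)"] by (simp add: B_def fmat_commute[of r t])
      then show ?thesis by (simp add: inner_axis' T_axis trace_eq_inner Wsym)
    qed
    moreover have "L (var_poly i s t) = Z $ i $ s $ t"
      using LB[of "Some (i, s, t)" None] by (simp add: B_def Tu inner_axis' fmat_inner Zsym)
    ultimately show "(\<Sum>r\<in>UNIV. L (var_poly i s r * var_poly i r t)) = L (var_poly i s t)"
      by (simp add: W3)
  next
    fix p :: "('q, 'n) zpoly" and k assume "affine_poly p" and k: "k \<in> {1..l}"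
    then obtain c where p: "p = lin_poly c" by (metis affine_poly_obtain_lin)
    \<comment> \<open>The constraint concerns the operators at C_k, whereas the moments record their
      values at \<open>fmat s t\<close>; expanding the symmetric matrix C_k connects the
      two.\<close>
    have "(\<Sum>s\<in>UNIV. \<Sum>t\<in>UNIV. C k $ s $ t *\<^sub>R W j i (fmat s t)) = W j i (C k)" for i j
      using arg_cong[OF sym_mat_expand[OF Csym[OF k]], of "W j i"]
      by (simp add: lin_op_on_sum[OF Wlin subspace_sym_mats] sum.cartesian_product case_prod_beta)
    then have "(\<Sum>i\<in>UNIV. lam i *\<^sub>R (\<Sum>s\<in>UNIV. \<Sum>t\<in>UNIV. C k $ s $ t *\<^sub>R T (axis i (fmat s t))))
        = b k *\<^sub>R Z"
      using W4[OF k] by (simp add: vec_eq_iff[where 'b = 'q] T_axis)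
    then show "(\<Sum>i\<in>UNIV. lam i * (\<Sum>s\<in>UNIV. \<Sum>t\<in>UNIV. C k $ s $ t * L (p * var_poly i s t)))
        = b k * L p"
      by (simp only: p L_linv L_lin1 inner_sum_right[symmetric] inner_scaleR_right[symmetric])
  qed
  moreover have "0 \<le> L (g\<^sup>2)" if "affine_poly g" for g
  proof -
    obtain c where g: "g = lin_poly c" using affine_poly_obtain_lin[OF \<open>affine_poly g\<close>] .
    \<comment> \<open>The tuple representing g, so that L(g^2) becomes the value at X of the
      quadratic form of \<open>T\<close>.\<close>
    define X where "X = (\<Sum>x\<in>UNIV. c x *\<^sub>R F x)"
    have X: "X \<in> sym_tuples"
      unfolding X_def using Fsym by (intro subspace_sum subspace_scale subspace_sym_tuples)
    have "g\<^sup>2 = (\<Sum>a\<in>UNIV. const_poly (c a) * (lin_poly c * basis_poly a))"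
      unfolding power2_eq_square g
      by (subst (2) lin_poly_def) (simp add: sum_distrib_left mult.left_commute)
    then have "L (g\<^sup>2) = X \<bullet> (\<Sum>a\<in>UNIV. c a *\<^sub>R T (F a))"
      by (simp add: Ls L_lin X_def inner_sum_right)
    also have "(\<Sum>a\<in>UNIV. c a *\<^sub>R T (F a)) = T X"
      unfolding X_def using Fsym by (simp add: lin_op_on_sum[OF Tlin subspace_sym_tuples])
    finally have "L (g\<^sup>2) = tuple_inner X (T X)"
      using Tsym[OF X] by (simp only: tuple_inner_eq_inner)
    then show ?thesis
      using psd X by (simp only: psd_op_def)
  qed
  ultimately show ?thesis using lin by (auto simp: feasible_functional_def)
qed

theorem proposition4:
  fixes lam :: "'q::finite \<Rightarrow> real" and m :: "'q \<Rightarrow> nat"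
    and l :: nat and C :: "nat \<Rightarrow> real^'n^'n" and b :: "nat \<Rightarrow> real"
  assumes "\<And>i. 0 < m i"
    and "(\<Sum>i\<in>UNIV. m i) = CARD('n)"
    and "\<And>k. k \<in> {1..l} \<Longrightarrow> C k \<in> sym_mats"
  shows "(relax2 lam m l C b \<noteq> {} \<and>
            - 1 \<notin> {f + p | f p. f \<in> ideal2 lam m l C b \<and> p \<in> sos_polys}) \<or>
         (relax2 lam m l C b = {} \<and>
            - 1 \<in> {f + p | f p. f \<in> ideal2 lam m l C b \<and> p \<in> sos_polys})"
proof -
  have "relax2 lam m l C b \<noteq> {} \<longleftrightarrow> (\<exists>L. feasible_functional lam m l C b L)"
    using feasible_functional_of_relax2[OF assms(2), of l C _ lam b] assms(3)
      relax2_nonempty[of lam m l C b] by blast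
  also have "\<dots> \<longleftrightarrow> - 1 \<notin> truncated_cone lam m l C b"
    using minus_one_notin_cone ex_feasible_functional by blast
  finally show ?thesis unfolding truncated_cone_def by blast
qed

end
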